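(* Let $s\geq 3$ be a fixed integer, and let $$c_s=\left(2\left(1-\frac{1}{s+1}\right)(s-2)!\right)^{\frac{2}{(s-2)(s+1)}},\qquad q_s(n)=n^{-\frac{2}{s+1}}(\ln n)^{\frac{2}{(s-2)(s+1)}}.$$ Let $p=p(n)\in[0,1]$ satisfy $p(n)\leq c_s q_s(n)$ for all sufficiently large $n$. Then, whp, the random graph $\mathbb{G}(n,p)$ does not have the property $\mathcal{A}_s$; that is, $$\mathbb{P}\left[\mathrm{wsat}\big(\mathbb{G}(n,p),K_s\big)=\binom{s-2}{2}+(s-2)(n-s+2)\right]\to 0\quad\text{as } n\to\infty.$$
   Context: All graphs are finite and simple. $K_s$ is the complete graph on $s$ vertices. Given a graph $F$, an $F$-bootstrap percolation process is a sequence of graphs $H_0\subset H_1\subset\cdots\subset H_m$ (on the same vertex set) such that, for $i=1,\ldots,m$, $H_i$ is obtained from $H_{i-1}$ by adding an edge that belongs to a copy of $F$ in $H_i$. Given graphs $G$ and $F$, a spanning subgraph $H$ of $G$ is a weakly $F$-saturated subgraph of $G$ if $H$ contains no subgraph isomorphic to $F$ and there is an $F$-bootstrap percolation process $H=H_0\subset H_1\subset\cdots\subset H_m=G$. The minimum number of edges in a weakly $F$-saturated subgraph of $G$ is denoted by $\mathrm{wsat}(G,F)$. $\mathbb{G}(n,p)$ is the Erdős–Rényi random graph on vertex set $\{1,\ldots,n\}$ in which each pair of distinct vertices is an edge with probability $p$ independently of all others. $\mathcal{A}_s$ is the property of an $n$-vertex graph $G$ that $\mathrm{wsat}(G,K_s)=\binom{s-2}{2}+(s-2)(n-s+2)$.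 "Whp" (with high probability) means with probability tending to $1$ as $n\to\infty$. *)

theory Defs
  imports "HOL-Probability.Probability" "HOL-Probability.Product_PMF"
begin

datatype 'a graph = Graph (verts: "'a set") (edges: "'a set set")

definition all_pairs :: "'a set \<Rightarrow> 'a set set" where
  "all_pairs V = {e. e \<subseteq> V \<and> card e = 2}"

definition simple_graph :: "'a graph \<Rightarrow> bool" where
  "simple_graph G \<longleftrightarrow> finite (verts G) \<and> edges G \<subseteq> all_pairs (verts G)"

definition subgraph :: "'a graph \<Rightarrow> 'a graph \<Rightarrow> bool" where
  "subgraph H G \<longleftrightarrow> simple_graph H \<and> verts H \<subseteq> verts G \<and> edges H \<subseteq> edges G"

definition spanning_subgraph :: "'a graph \<Rightarrow> 'a graph \<Rightarrow> bool" where
  "spanning_subgraph H G \<longleftrightarrow> subgraph H G \<and> verts H = verts G"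

definition isomorphic :: "'a graph \<Rightarrow> 'b graph \<Rightarrow> bool" where
  "isomorphic F G \<longleftrightarrow>
     (\<exists>f. bij_betw f (verts F) (verts G) \<and> edges G = (\<lambda>e. f ` e) ` edges F)"

text \<open>A copy need not be an induced subgraph.\<close>

definition copy_in :: "'a graph \<Rightarrow> 'b graph \<Rightarrow> 'a graph \<Rightarrow> bool" where
  "copy_in C F G \<longleftrightarrow> subgraph C G \<and> isomorphic F C"

definition complete_graph :: "nat \<Rightarrow> nat graph" where
  "complete_graph s = Graph {1..s} (all_pairs {1..s})"

definition bootstrap_step :: "'b graph \<Rightarrow> 'a graph \<Rightarrow> 'a graph \<Rightarrow> bool" where
  "bootstrap_step F H H' \<longleftrightarrow>
     (\<exists>e. e \<in> all_pairs (verts H) \<and> e \<notin> edges H \<and>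
          H' = Graph (verts H) (insert e (edges H)) \<and>
          (\<exists>C. copy_in C F H' \<and> e \<in> edges C))"

text \<open>Only the entries \<open>Hs 0, \<dots>, Hs m\<close> matter.\<close>

definition bootstrap_process :: "'b graph \<Rightarrow> nat \<Rightarrow> (nat \<Rightarrow> 'a graph) \<Rightarrow> bool" where
  "bootstrap_process F m Hs \<longleftrightarrow>
     (\<forall>i\<le>m. simple_graph (Hs i)) \<and> (\<forall>i\<in>{1..m}. bootstrap_step F (Hs (i - 1)) (Hs i))"

definition weakly_saturated :: "'a graph \<Rightarrow> 'b graph \<Rightarrow> 'a graph \<Rightarrow> bool" where
  "weakly_saturated G F H \<longleftrightarrow>
     spanning_subgraph H G \<and> (\<nexists>C. copy_in C F H) \<and>
     (\<exists>m Hs. bootstrap_process F m Hs \<and> Hs 0 = H \<and> Hs m = G)"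

text \<open>If \<open>F\<close> has an edge, every finite simple graph \<open>G\<close> has a weakly \<open>F\<close>-saturated
  subgraph (delete edges lying in copies of \<open>F\<close> until no copy is left), so the minimum is
  taken over a nonempty set.\<close>

definition wsat :: "'a graph \<Rightarrow> 'b graph \<Rightarrow> nat" where
  "wsat G F = (LEAST k. \<exists>H. weakly_saturated G F H \<and> card (edges H) = k)"

definition erdos_renyi :: "nat \<Rightarrow> real \<Rightarrow> nat graph pmf" where
  "erdos_renyi n p =
     map_pmf (\<lambda>b. Graph {1..n} {e \<in> all_pairs {1..n}. b e})
       (Pi_pmf (all_pairs {1..n}) False (\<lambda>_. bernoulli_pmf p))"

text \<open>The product \<open>(s - 2)(n - s + 2)\<close> is formed in the integers, since subtraction of natural
  numbers truncates.\<close>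

definition property_A :: "nat \<Rightarrow> 'a graph \<Rightarrow> bool" where
  "property_A s G \<longleftrightarrow>
     int (wsat G (complete_graph s)) =
       int ((s - 2) choose 2) + (int s - 2) * (int (card (verts G)) - int s + 2)"

definition c_const :: "nat \<Rightarrow> real" where
  "c_const s =
     (2 * (1 - 1 / (real s + 1)) * fact (s - 2)) powr (2 / ((real s - 2) * (real s + 1)))"

definition q_fun :: "nat \<Rightarrow> nat \<Rightarrow> real" where
  "q_fun s n =
     real n powr (- 2 / (real s + 1)) * ln (real n) powr (2 / ((real s - 2) * (real s + 1)))"

end

theory Submission
  imports Defs "HOL-Real_Asymp.Real_Asymp"
begin

text \<open>Write \<open>T\<close> for \<open>wsat(G, K\<^sub>s)\<close>. If a pair \<open>e\<close> is not an edge of \<open>G\<close> and adding it creates no \<open>K\<^sub>s\<close> through \<open>e\<close>,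
  then \<open>T(G + e) = T(G) + 1\<close>, since \<open>e\<close> must belong to every weakly saturated subgraph of \<open>G + e\<close>. Let \<open>X\<close> be the
  number of edges lying in no \<open>K\<^sub>s\<close> and \<open>Z\<close> the number of non-edges whose addition creates no \<open>K\<^sub>s\<close>. Comparing the
  weights of \<open>G\<close> and \<open>G + e\<close> gives \<open>(1 - p) E[X; T = k + 1] = p E[Z; T = k]\<close>. Janson's and Harris' inequalities
  show that \<open>X\<close> and \<open>Z\<close> are concentrated, about values \<open>M\<close> and \<open>M / p\<close>, whenever \<open>M\<close> tends to infinity. Hence
  \<open>P(T = k) \<le> P(T = k + 1) + o(1)\<close> uniformly in \<open>k\<close>, and therefore \<open>P(T = k)\<close> tends to 0 uniformly in \<open>k\<close>. For \<open>p\<close> up to \<open>c\<^sub>s q\<^sub>s(n)\<close>, the value \<open>M\<close> tends to infinity unless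
  \<open>p = o(1/n)\<close>, and then with high probability \<open>G\<close> has fewer edges than the required value of \<open>T\<close>.\<close>

section \<open>Random subsets\<close>

text \<open>The constant \<open>c_const s\<close> is the point up to which \<open>M\<close>
  diverges. With \<open>k = (s choose 2) - 1\<close>, adding a given pair creates no
  \<open>K_s\<close> with probability about exp(- n^(s-2) p^k / (s-2)!). At p = c_s q_s(n) this is
  n^(-\<beta>) for \<beta> = 2 - 2/(s+1), while n^2 p is n^\<beta> times \<Lambda> = (A ln n)^(1/k)
  with A = \<beta> (s-2)!. The powers of n cancel, and the slowly growing \<Lambda> is all that
  remains.

  The obstacle is the dependence among cliques. Concentration needs the events for two pairs to be
  independent up to a factor 1 + o(1); a merely bounded factor would leave a relative variance of
  order one. The gain comes from counting edges: two cliques that share an edge other than the pairs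
  they complete have so many edges in their union that their joint probability beats the number of
  placements by n^(1/(s+1)), up to logarithms.

  The one-step comparison is iterated over \<open>J\<close> consecutive values: these are disjoint
  events, each of probability at least P(T = k) - o(1), so P(T = k) is at most 1/J + o(1), with
  \<open>J\<close> fixed before n grows.\<close>

definition expect :: "real \<Rightarrow> 'a set \<Rightarrow> ('a set \<Rightarrow> real) \<Rightarrow> real" where
  "expect p E f = (\<Sum>\<omega>\<in>Pow E. (\<Prod>e\<in>E. if e \<in> \<omega> then p else 1 - p) * f \<omega>)"

lemma expect_empty [simp]: "expect p {} f = f {}"
  by (simp add: expect_def)

text \<open>Exposing one coordinate. With the expectation written as a finite weighted sum this is
  an algebraic identity for every real \<open>p\<close>, and it drives the inductions on the ground
  set; only order comparisons require \<open>p\<close> to lie in [0, 1].\<close>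

lemma expect_insert:
  assumes "finite E" "e \<notin> E"
  shows "expect p (insert e E) f = p * expect p E (\<lambda>\<omega>. f (insert e \<omega>)) + (1 - p) * expect p E f"
proof -
  let ?w = "\<lambda>E \<omega>. \<Prod>x\<in>E. if x \<in> \<omega> then p else 1 - p"
  have w1: "?w (insert e E) (insert e \<omega>) = p * ?w E \<omega>" if "\<omega> \<in> Pow E" for \<omega>
  proof -
    have "?w E (insert e \<omega>) = ?w E \<omega>"
      using assms by (intro prod.cong) auto
    then show ?thesis using assms by simp
  qed
  have w0: "?w (insert e E) \<omega> = (1 - p) * ?w E \<omega>" if "\<omega> \<in> Pow E" for \<omega>
    using assms that by auto
  have "expect p (insert e E) f
      = (\<Sum>\<omega>\<in>Pow E. ?w (insert e E) \<omega> * f \<omega>) + (\<Sum>\<omega>\<in>insert e ` Pow E. ?w (insert e E) \<omega> * f \<omega>)"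
    unfolding expect_def Pow_insert using assms by (intro sum.union_disjoint) auto
  also have "(\<Sum>\<omega>\<in>insert e ` Pow E. ?w (insert e E) \<omega> * f \<omega>)
      = (\<Sum>\<omega>\<in>Pow E. ?w (insert e E) (insert e \<omega>) * f (insert e \<omega>))"
    using assms by (subst sum.reindex) (auto simp: inj_on_def)
  also have "\<dots> = (\<Sum>\<omega>\<in>Pow E. p * (?w E \<omega> * f (insert e \<omega>)))"
    by (intro sum.cong refl) (simp only: w1 mult.assoc)
  also have "(\<Sum>\<omega>\<in>Pow E. ?w (insert e E) \<omega> * f \<omega>) = (\<Sum>\<omega>\<in>Pow E. (1 - p) * (?w E \<omega> * f \<omega>))"
    by (intro sum.cong refl) (simp only: w0 mult.assoc)
  finally show ?thesis
    by (simp add: expect_def sum_distrib_left)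
qed

lemma expect_cong: "(\<And>\<omega>. \<omega> \<subseteq> E \<Longrightarrow> f \<omega> = g \<omega>) \<Longrightarrow> expect p E f = expect p E g"
  unfolding expect_def by (intro sum.cong) auto

lemma expect_add: "expect p E (\<lambda>\<omega>. f \<omega> + g \<omega>) = expect p E f + expect p E g"
  by (simp add: expect_def algebra_simps sum.distrib)

lemma expect_diff: "expect p E (\<lambda>\<omega>. f \<omega> - g \<omega>) = expect p E f - expect p E g"
  by (simp add: expect_def algebra_simps sum_subtractf)

lemma expect_cmult: "expect p E (\<lambda>\<omega>. c * f \<omega>) = c * expect p E f"
  by (simp add: expect_def sum_distrib_left mult.left_commute)

lemma expect_uminus: "expect p E (\<lambda>\<omega>. - f \<omega>) = - expect p E f"
  using expect_cmult[of p E "-1" f] by simp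

lemma expect_sum: "expect p E (\<lambda>\<omega>. \<Sum>i\<in>I. f i \<omega>) = (\<Sum>i\<in>I. expect p E (f i))"
  unfolding expect_def by (subst sum.swap) (simp add: sum_distrib_left)

lemma expect_const: "finite E \<Longrightarrow> expect p E (\<lambda>_. c) = c"
  by (induction E rule: finite_induct) (simp_all add: expect_insert algebra_simps)

lemma expect_mono:
  assumes "0 \<le> p" "p \<le> 1" "\<And>\<omega>. \<omega> \<subseteq> E \<Longrightarrow> f \<omega> \<le> g \<omega>"
  shows "expect p E f \<le> expect p E g"
  unfolding expect_def using assms
  by (intro sum_mono mult_left_mono) (auto intro!: prod_nonneg)

lemma expect_nonneg:
  assumes "0 \<le> p" "p \<le> 1" "\<And>\<omega>. \<omega> \<subseteq> E \<Longrightarrow> 0 \<le> f \<omega>"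
  shows "0 \<le> expect p E f"
  unfolding expect_def using assms
  by (intro sum_nonneg mult_nonneg_nonneg) (auto intro!: prod_nonneg)

text \<open>The variance of the absolute value of \<open>f\<close> is nonnegative. Second moment
  bounds become bounds on the mean deviation in this way.\<close>

lemma expect_abs_le_sqrt:
  assumes "finite E" "0 \<le> p" "p \<le> 1"
  shows "expect p E (\<lambda>\<omega>. \<bar>f \<omega>\<bar>) \<le> sqrt (expect p E (\<lambda>\<omega>. (f \<omega>)\<^sup>2))"
proof -
  define m where "m = expect p E (\<lambda>\<omega>. \<bar>f \<omega>\<bar>)"
  have "0 \<le> expect p E (\<lambda>\<omega>. (\<bar>f \<omega>\<bar> - m)\<^sup>2)"
    using assms by (intro expect_nonneg) auto
  also have "(\<lambda>\<omega>. (\<bar>f \<omega>\<bar> - m)\<^sup>2) = (\<lambda>\<omega>. ((f \<omega>)\<^sup>2 - (2 * m) * \<bar>f \<omega>\<bar>) + m\<^sup>2)"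
    by (auto simp: power2_eq_square algebra_simps)
  also have "expect p E \<dots> = expect p E (\<lambda>\<omega>. (f \<omega>)\<^sup>2) - m\<^sup>2"
    using assms
    by (simp only: expect_add expect_diff expect_cmult expect_const m_def[symmetric])
      (simp add: power2_eq_square)
  finally show ?thesis
    by (simp add: m_def real_le_rsqrt)
qed

text \<open>The hypothesis on \<open>g\<close> says that \<open>g\<close> ignores the coordinates in
  \<open>A\<close>; exposing these coordinates one at a time pulls out one factor \<open>p\<close>
  each.\<close>

lemma expect_indep:
  assumes "finite E" "A \<subseteq> E" and g: "\<And>\<omega>. \<omega> \<subseteq> E \<Longrightarrow> g (\<omega> - A) = g \<omega>"
  shows "expect p E (\<lambda>\<omega>. of_bool (A \<subseteq> \<omega>) * g \<omega>) = p ^ card A * expect p E g"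
proof -
  have "finite A" using assms finite_subset by blast
  then show ?thesis using assms(2) g
  proof (induction A arbitrary: g rule: finite_induct)
    case empty
    then show ?case by simp
  next
    case (insert a A)
    have gA: "g (\<omega> - A) = g \<omega>" if "\<omega> \<subseteq> E" for \<omega>
    proof -
      have "g (\<omega> - A) = g ((\<omega> - A) - insert a A)" using that by (intro insert.prems(2)[symmetric]) auto
      also have "(\<omega> - A) - insert a A = \<omega> - insert a A" by auto
      finally show ?thesis using insert.prems(2) that by simp
    qed
    have ga: "g (\<omega> - {a}) = g \<omega>" if "\<omega> \<subseteq> E" for \<omega>
    proof -
      have "g (\<omega> - {a}) = g ((\<omega> - {a}) - insert a A)" using that by (intro insert.prems(2)[symmetric]) auto
      also have "(\<omega> - {a}) - insert a A = \<omega> - insert a A" by auto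
      finally show ?thesis using insert.prems(2) that by simp
    qed
    define E' where "E' = E - {a}"
    have E: "E = insert a E'" "a \<notin> E'" "finite E'" "A \<subseteq> E'"
      using insert \<open>finite E\<close> by (auto simp: E'_def)
    have gi: "g (insert a \<omega>) = g \<omega>" if "\<omega> \<subseteq> E'" for \<omega>
    proof -
      have "insert a \<omega> - {a} = \<omega>" "insert a \<omega> \<subseteq> E" using that E by auto
      then show ?thesis using ga[of "insert a \<omega>"] by simp
    qed
    have "expect p E (\<lambda>\<omega>. of_bool (insert a A \<subseteq> \<omega>) * g \<omega>)
        = p * expect p E' (\<lambda>\<omega>. of_bool (insert a A \<subseteq> insert a \<omega>) * g (insert a \<omega>))
          + (1 - p) * expect p E' (\<lambda>\<omega>. of_bool (insert a A \<subseteq> \<omega>) * g \<omega>)"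
      unfolding E(1) using E by (intro expect_insert) auto
    also have "expect p E' (\<lambda>\<omega>. of_bool (insert a A \<subseteq> insert a \<omega>) * g (insert a \<omega>))
        = expect p E' (\<lambda>\<omega>. of_bool (A \<subseteq> \<omega>) * g \<omega>)"
      using E insert.hyps by (intro expect_cong) (auto simp: gi)
    also have "expect p E' (\<lambda>\<omega>. of_bool (insert a A \<subseteq> \<omega>) * g \<omega>) = expect p E' (\<lambda>_. 0)"
      using E by (intro expect_cong) auto
    also have "expect p E' (\<lambda>\<omega>. of_bool (A \<subseteq> \<omega>) * g \<omega>) = expect p E (\<lambda>\<omega>. of_bool (A \<subseteq> \<omega>) * g \<omega>)"
    proof -
      have "expect p E (\<lambda>\<omega>. of_bool (A \<subseteq> \<omega>) * g \<omega>)
        = p * expect p E' (\<lambda>\<omega>. of_bool (A \<subseteq> insert a \<omega>) * g (insert a \<omega>))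
          + (1 - p) * expect p E' (\<lambda>\<omega>. of_bool (A \<subseteq> \<omega>) * g \<omega>)"
        unfolding E(1) using E by (intro expect_insert) auto
      also have "expect p E' (\<lambda>\<omega>. of_bool (A \<subseteq> insert a \<omega>) * g (insert a \<omega>))
        = expect p E' (\<lambda>\<omega>. of_bool (A \<subseteq> \<omega>) * g \<omega>)"
        using E insert.hyps by (intro expect_cong) (auto simp: gi)
      finally show ?thesis by (simp add: algebra_simps)
    qed
    also have "\<dots> = p ^ card A * expect p E g"
      using insert gA by auto
    finally show ?case using insert.hyps E by (simp add: expect_const)
  qed
qed

lemma expect_superset:
  assumes "finite E" "A \<subseteq> E"
  shows "expect p E (\<lambda>\<omega>. of_bool (A \<subseteq> \<omega>)) = p ^ card A"
  using expect_indep[OF assms, of "\<lambda>_. 1" p] assms by (simp add: expect_const)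

section \<open>Correlation inequalities of Harris and Janson\<close>

text \<open>Exposing the coordinate \<open>e\<close> splits the covariance into the covariances in
  the two branches, nonnegative by induction, and p (1 - p) (F0 - F1) (G0 - G1). The last term is
  nonnegative because both functions decrease when \<open>e\<close> is inserted.\<close>

lemma harris:
  assumes "finite E" "0 \<le> p" "p \<le> 1"
    and "\<And>\<omega> \<omega>'. \<omega> \<subseteq> \<omega>' \<Longrightarrow> \<omega>' \<subseteq> E \<Longrightarrow> f \<omega>' \<le> f \<omega>"
    and "\<And>\<omega> \<omega>'. \<omega> \<subseteq> \<omega>' \<Longrightarrow> \<omega>' \<subseteq> E \<Longrightarrow> g \<omega>' \<le> g \<omega>"
  shows "expect p E f * expect p E g \<le> expect p E (\<lambda>\<omega>. f \<omega> * g \<omega>)"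
  using assms(1,4,5)
proof (induction E arbitrary: f g rule: finite_induct)
  case empty
  then show ?case by simp
next
  case (insert e E)
  let ?f = "\<lambda>\<omega>. f (insert e \<omega>)" and ?g = "\<lambda>\<omega>. g (insert e \<omega>)"
  define F0 F1 G0 G1 where
    "F0 = expect p E f" and "F1 = expect p E ?f" and "G0 = expect p E g" and "G1 = expect p E ?g"
  have IH0: "F0 * G0 \<le> expect p E (\<lambda>\<omega>. f \<omega> * g \<omega>)"
    unfolding F0_def G0_def by (intro insert.IH insert.prems) auto
  have IH1: "F1 * G1 \<le> expect p E (\<lambda>\<omega>. ?f \<omega> * ?g \<omega>)"
    unfolding F1_def G1_def by (intro insert.IH insert.prems) auto
  have "F1 \<le> F0" "G1 \<le> G0"
    unfolding F0_def F1_def G0_def G1_def using assms(2,3)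
    by (auto intro!: expect_mono insert.prems)
  then have "0 \<le> (p * (1 - p)) * ((F0 - F1) * (G0 - G1))"
    using assms(2,3) by (intro mult_nonneg_nonneg) auto
  then have "(p * F1 + (1 - p) * F0) * (p * G1 + (1 - p) * G0) \<le> p * (F1 * G1) + (1 - p) * (F0 * G0)"
    by (simp add: algebra_simps)
  also have "\<dots> \<le> p * expect p E (\<lambda>\<omega>. ?f \<omega> * ?g \<omega>) + (1 - p) * expect p E (\<lambda>\<omega>. f \<omega> * g \<omega>)"
    using assms(2,3) IH0 IH1 by (intro add_mono mult_left_mono) auto
  finally show ?case
    using insert.hyps by (simp add: expect_insert F0_def F1_def G0_def G1_def)
qed

lemma harris_opposite:
  assumes "finite E" "0 \<le> p" "p \<le> 1"
    and "\<And>\<omega> \<omega>'. \<omega> \<subseteq> \<omega>' \<Longrightarrow> \<omega>' \<subseteq> E \<Longrightarrow> f \<omega> \<le> f \<omega>'"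
    and "\<And>\<omega> \<omega>'. \<omega> \<subseteq> \<omega>' \<Longrightarrow> \<omega>' \<subseteq> E \<Longrightarrow> g \<omega>' \<le> g \<omega>"
  shows "expect p E (\<lambda>\<omega>. f \<omega> * g \<omega>) \<le> expect p E f * expect p E g"
  using harris[OF assms(1-3), of "\<lambda>\<omega>. - f \<omega>" g] assms(4,5) by (simp add: expect_uminus)

definition avoids :: "('i \<Rightarrow> 'a set) \<Rightarrow> 'i set \<Rightarrow> 'a set \<Rightarrow> bool" where
  "avoids A J \<omega> \<longleftrightarrow> (\<forall>j\<in>J. \<not> A j \<subseteq> \<omega>)"

lemma avoids_antimono: "\<omega> \<subseteq> \<omega>' \<Longrightarrow> avoids A J \<omega>' \<Longrightarrow> avoids A J \<omega>"
  unfolding avoids_def by blast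

lemma avoids_subset: "J' \<subseteq> J \<Longrightarrow> avoids A J \<omega> \<Longrightarrow> avoids A J' \<omega>"
  unfolding avoids_def by blast

text \<open>Avoiding one set is a decreasing event, so Harris' inequality makes all these events
  positively correlated. This is the lower bound that matches Janson's upper bound.\<close>

lemma avoids_ge_prod:
  assumes "finite E" "0 \<le> p" "p \<le> 1" "finite J" "\<And>j. j \<in> J \<Longrightarrow> A j \<subseteq> E"
  shows "(\<Prod>j\<in>J. 1 - p ^ card (A j)) \<le> expect p E (\<lambda>\<omega>. of_bool (avoids A J \<omega>))"
  using assms(4,5)
proof (induction J rule: finite_induct)
  case empty
  then show ?case using assms(1) by (simp add: avoids_def expect_const)
next
  case (insert i J)
  have "(\<Prod>j\<in>insert i J. 1 - p ^ card (A j))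
      \<le> (1 - p ^ card (A i)) * expect p E (\<lambda>\<omega>. of_bool (avoids A J \<omega>))"
    using insert assms(2,3) by (auto intro!: mult_left_mono simp: power_le_one)
  also have "1 - p ^ card (A i) = expect p E (\<lambda>\<omega>. 1 - of_bool (A i \<subseteq> \<omega>))"
    using insert assms(1) by (simp add: expect_diff expect_const expect_superset)
  also have "\<dots> * expect p E (\<lambda>\<omega>. of_bool (avoids A J \<omega>))
      \<le> expect p E (\<lambda>\<omega>. (1 - of_bool (A i \<subseteq> \<omega>)) * of_bool (avoids A J \<omega>))"
    using assms(1-3) by (intro harris) (auto dest: avoids_antimono)
  also have "\<dots> = expect p E (\<lambda>\<omega>. of_bool (avoids A (insert i J) \<omega>))"
    by (intro expect_cong) (auto simp: avoids_def)
  finally show ?case .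
qed

text \<open>In conditional form: given that \<open>J\<close> is avoided, \<open>A i\<close> still
  occurs with probability at least \<open>p ^ card (A i)\<close> minus the sum. Avoiding the sets
  disjoint from \<open>A i\<close> (indices \<open>J0\<close>) is independent of \<open>A i\<close>;
  the sets meeting it (indices \<open>J1\<close>) are handled by a union bound.\<close>

lemma janson_step:
  assumes "finite E" "0 \<le> p" "p \<le> 1" "finite J" "\<And>j. j \<in> insert i J \<Longrightarrow> A j \<subseteq> E"
  shows "expect p E (\<lambda>\<omega>. of_bool (avoids A (insert i J) \<omega>))
    \<le> expect p E (\<lambda>\<omega>. of_bool (avoids A J \<omega>))
      * (1 - p ^ card (A i) + (\<Sum>j | j \<in> J \<and> A j \<inter> A i \<noteq> {}. p ^ card (A i \<union> A j)))"
proof -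
  define J0 J1 where "J0 = {j \<in> J. A j \<inter> A i = {}}" and "J1 = {j \<in> J. A j \<inter> A i \<noteq> {}}"
  define P0 P where "P0 = expect p E (\<lambda>\<omega>. of_bool (avoids A J0 \<omega>))"
    and "P = expect p E (\<lambda>\<omega>. of_bool (avoids A J \<omega>))"
  define d where "d = p ^ card (A i) - (\<Sum>j\<in>J1. p ^ card (A i \<union> A j))"
  define Q where "Q = expect p E (\<lambda>\<omega>. of_bool (A i \<subseteq> \<omega> \<and> avoids A J \<omega>))"
  have indep: "avoids A J0 (\<omega> - A i) = avoids A J0 \<omega>" for \<omega>
    unfolding avoids_def J0_def by blast
  have first: "expect p E (\<lambda>\<omega>. of_bool (A i \<subseteq> \<omega>) * of_bool (avoids A J0 \<omega>)) = p ^ card (A i) * P0"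
    unfolding P0_def using assms by (intro expect_indep) (auto simp: indep)
  \<comment> \<open>Containing the union is an increasing event and avoiding \<open>J0\<close> a
    decreasing one, so the two are negatively correlated.\<close>
  have second: "expect p E (\<lambda>\<omega>. of_bool (A i \<union> A j \<subseteq> \<omega>) * of_bool (avoids A J0 \<omega>))
      \<le> p ^ card (A i \<union> A j) * P0" if "j \<in> J1" for j
  proof -
    have "expect p E (\<lambda>\<omega>. of_bool (A i \<union> A j \<subseteq> \<omega>) * of_bool (avoids A J0 \<omega>))
      \<le> expect p E (\<lambda>\<omega>. of_bool (A i \<union> A j \<subseteq> \<omega>)) * P0"
      unfolding P0_def using assms(1-3) by (intro harris_opposite) (auto dest: avoids_antimono)
    moreover have "A i \<union> A j \<subseteq> E" using that assms(5) by (auto simp: J1_def)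
    ultimately show ?thesis by (simp only: expect_superset[OF assms(1)])
  qed
  have "P0 * d = p ^ card (A i) * P0 - (\<Sum>j\<in>J1. p ^ card (A i \<union> A j) * P0)"
    by (simp add: d_def sum_distrib_left algebra_simps)
  also have "\<dots> \<le> expect p E (\<lambda>\<omega>. of_bool (A i \<subseteq> \<omega>) * of_bool (avoids A J0 \<omega>))
      - (\<Sum>j\<in>J1. expect p E (\<lambda>\<omega>. of_bool (A i \<union> A j \<subseteq> \<omega>) * of_bool (avoids A J0 \<omega>)))"
    using second by (simp add: first sum_mono)
  also have "\<dots> = expect p E (\<lambda>\<omega>. of_bool (A i \<subseteq> \<omega>) * of_bool (avoids A J0 \<omega>)
      - (\<Sum>j\<in>J1. of_bool (A i \<union> A j \<subseteq> \<omega>) * of_bool (avoids A J0 \<omega>)))"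
    by (simp only: expect_diff expect_sum)
  also have "\<dots> \<le> Q"
    unfolding Q_def
  proof (intro expect_mono assms(2,3))
    fix \<omega> assume "\<omega> \<subseteq> E"
    let ?h = "\<lambda>j. of_bool (A i \<union> A j \<subseteq> \<omega>) * of_bool (avoids A J0 \<omega>) :: real"
    have fin: "finite J1" using assms(4) by (simp add: J1_def)
    show "of_bool (A i \<subseteq> \<omega>) * of_bool (avoids A J0 \<omega>) - sum ?h J1
        \<le> (of_bool (A i \<subseteq> \<omega> \<and> avoids A J \<omega>) :: real)"
    proof (cases "A i \<subseteq> \<omega> \<and> avoids A J0 \<omega> \<and> \<not> avoids A J \<omega>")
      case True
      then obtain j where "j \<in> J1" "A j \<subseteq> \<omega>"
        unfolding avoids_def J0_def J1_def by blast
      then have "?h j \<le> sum ?h J1" using fin by (intro member_le_sum) auto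
      then show ?thesis using True \<open>A j \<subseteq> \<omega>\<close> by auto
    next
      case False
      have "0 \<le> sum ?h J1" by (intro sum_nonneg) auto
      then show ?thesis using False avoids_subset[of J0 J A \<omega>] by (auto simp: J0_def)
    qed
  qed
  finally have Q0: "P0 * d \<le> Q" .
  have "P \<le> P0"
    unfolding P_def P0_def using assms(2,3)
    by (intro expect_mono) (auto simp: J0_def avoids_def)
  moreover have "0 \<le> P" "0 \<le> Q"
    unfolding P_def Q_def using assms(2,3) by (auto intro!: expect_nonneg)
  \<comment> \<open>The sign of \<open>d\<close> is unknown: if it is negative, \<open>P * d\<close>
    is at most 0, hence at most \<open>Q\<close>; otherwise \<open>P\<close> may be replaced by the
    larger \<open>P0\<close>.\<close>
  ultimately have "P * d \<le> Q"
    using Q0 mult_right_mono[of P P0 d] mult_nonneg_nonpos[of P d] by linarith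
  have "expect p E (\<lambda>\<omega>. of_bool (avoids A (insert i J) \<omega>))
      = expect p E (\<lambda>\<omega>. of_bool (avoids A J \<omega>) - of_bool (A i \<subseteq> \<omega> \<and> avoids A J \<omega>))"
    by (intro expect_cong) (auto simp: avoids_def)
  also have "\<dots> = P - Q" by (simp add: expect_diff P_def Q_def)
  also have "\<dots> \<le> P * (1 - d)" using \<open>P * d \<le> Q\<close> by (simp add: algebra_simps)
  also have "1 - d = 1 - p ^ card (A i) + (\<Sum>j\<in>J1. p ^ card (A i \<union> A j))" by (simp add: d_def)
  finally show ?thesis by (simp only: P_def J1_def)
qed

text \<open>Each index contributes a factor 1 - a + d, which is at most (1 - a) exp(2 d) because a
  is at most 1/2; this is the origin of the 2 in the exponent.\<close>

lemma janson:
  assumes "finite E" "0 \<le> p" "p \<le> 1" "finite J"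
    and "\<And>j. j \<in> J \<Longrightarrow> A j \<subseteq> E" "\<And>j. j \<in> J \<Longrightarrow> p ^ card (A j) \<le> 1 / 2"
  shows "expect p E (\<lambda>\<omega>. of_bool (avoids A J \<omega>))
    \<le> (\<Prod>j\<in>J. 1 - p ^ card (A j))
      * exp (2 * (\<Sum>(i, j) | i \<in> J \<and> j \<in> J \<and> i \<noteq> j \<and> A j \<inter> A i \<noteq> {}. p ^ card (A i \<union> A j)))"
  using assms(4-6)
proof (induction J rule: finite_induct)
  case empty
  then show ?case using assms(1) by (simp add: avoids_def expect_const)
next
  case (insert i J)
  let ?S = "\<lambda>J. {(i, j). i \<in> J \<and> j \<in> J \<and> i \<noteq> j \<and> A j \<inter> A i \<noteq> {}}"
  let ?h = "\<lambda>(i, j). p ^ card (A i \<union> A j)"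
  define d where "d = (\<Sum>j | j \<in> J \<and> A j \<inter> A i \<noteq> {}. p ^ card (A i \<union> A j))"
  define a where "a = p ^ card (A i)"
  have a: "a \<le> 1 / 2" "0 \<le> a" using insert.prems assms(2) by (auto simp: a_def)
  have d0: "0 \<le> d" unfolding d_def using assms(2) by (intro sum_nonneg) auto
  have fin: "finite (?S (insert i J))"
    by (rule finite_subset[of _ "insert i J \<times> insert i J"]) (use insert.hyps in auto)
  \<comment> \<open>Among the ordered pairs containing the new index, those with it in first place
    already account for \<open>d\<close>; the others are surplus.\<close>
  have "d + sum ?h (?S J) = sum ?h (Pair i ` {j \<in> J. A j \<inter> A i \<noteq> {}}) + sum ?h (?S J)"
    by (subst sum.reindex) (auto simp: inj_on_def d_def)
  also have "\<dots> = sum ?h (Pair i ` {j \<in> J. A j \<inter> A i \<noteq> {}} \<union> ?S J)"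
    using insert.hyps by (intro sum.union_disjoint[symmetric] finite_subset[OF _ fin]) auto
  also have "\<dots> \<le> sum ?h (?S (insert i J))"
    using insert.hyps fin assms(2) by (intro sum_mono2) auto
  finally have le: "d + sum ?h (?S J) \<le> sum ?h (?S (insert i J))" .
  have "1 - a + d \<le> (1 - a) * (1 + 2 * d)"
    using mult_right_mono[OF a(1) d0] by (simp add: algebra_simps)
  also have "\<dots> \<le> (1 - a) * exp (2 * d)"
    using a by (intro mult_left_mono exp_ge_add_one_self) auto
  finally have step: "1 - a + d \<le> (1 - a) * exp (2 * d)" .
  have prod0: "0 \<le> (\<Prod>j\<in>J. 1 - p ^ card (A j))"
    using assms(2,3) by (intro prod_nonneg) (auto simp: power_le_one)
  have "expect p E (\<lambda>\<omega>. of_bool (avoids A (insert i J) \<omega>))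
      \<le> expect p E (\<lambda>\<omega>. of_bool (avoids A J \<omega>)) * (1 - a + d)"
    unfolding a_def d_def using insert assms(1-3) by (intro janson_step) auto
  also have "\<dots> \<le> ((\<Prod>j\<in>J. 1 - p ^ card (A j)) * exp (2 * sum ?h (?S J))) * ((1 - a) * exp (2 * d))"
    using insert a d0 prod0 step by (intro mult_mono) auto
  also have "\<dots> = (\<Prod>j\<in>insert i J. 1 - p ^ card (A j)) * exp (2 * (d + sum ?h (?S J)))"
    using insert.hyps by (simp add: a_def distrib_left exp_add)
  also have "\<dots> \<le> (\<Prod>j\<in>insert i J. 1 - p ^ card (A j)) * exp (2 * sum ?h (?S (insert i J)))"
    using le insert.hyps prod0 a by (intro mult_left_mono) (auto simp: a_def)
  finally show ?case .
qed

section \<open>Anti-concentration of a statistic raised by single flips\<close>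

text \<open>\<open>T\<close> is the statistic, and \<open>B e\<close> is an event not depending on \<open>e\<close> on which inserting \<open>e\<close> raises \<open>T\<close> by one.\<close>

locale flip_statistic =
  fixes E :: "'a set" and p \<rho> \<eta> :: real and B :: "'a \<Rightarrow> 'a set \<Rightarrow> bool" and T :: "'a set \<Rightarrow> nat"
  assumes fin: "finite E" and nonempty: "E \<noteq> {}"
    and p: "0 < p" "p < 1" and rho: "0 < \<rho>" and eta: "1 \<le> \<eta>"
    and B_antimono: "\<And>e \<omega> \<omega>'. \<omega> \<subseteq> \<omega>' \<Longrightarrow> B e \<omega>' \<Longrightarrow> B e \<omega>"
    and B_indep: "\<And>e \<omega>. B e (\<omega> - {e}) = B e \<omega>"
    and B_lower: "\<And>e. e \<in> E \<Longrightarrow> \<rho> \<le> expect p E (\<lambda>\<omega>. of_bool (B e \<omega>))"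
    and B_upper: "\<And>e. e \<in> E \<Longrightarrow> expect p E (\<lambda>\<omega>. of_bool (B e \<omega>)) \<le> \<rho> * \<eta>"
    and B_pair: "\<And>e e'. e \<in> E \<Longrightarrow> e' \<in> E \<Longrightarrow> e \<noteq> e' \<Longrightarrow>
      expect p E (\<lambda>\<omega>. of_bool (B e \<omega> \<and> B e' \<omega>)) \<le> \<rho>\<^sup>2 * \<eta>"
    and T_flip: "\<And>e \<omega>. e \<in> E \<Longrightarrow> \<omega> \<subseteq> E \<Longrightarrow> e \<notin> \<omega> \<Longrightarrow> B e \<omega> \<Longrightarrow> T (insert e \<omega>) = Suc (T \<omega>)"
begin

text \<open>\<open>X\<close> counts elements whose removal lowers \<open>T\<close> by one,
  \<open>Z\<close> those whose insertion raises it by one, in both cases only as far as the event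
  \<open>B e\<close> guarantees this.\<close>

definition X :: "'a set \<Rightarrow> real" where
  "X \<omega> = (\<Sum>e\<in>E. of_bool (e \<in> \<omega> \<and> B e \<omega>))"

definition Z :: "'a set \<Rightarrow> real" where
  "Z \<omega> = (\<Sum>e\<in>E. of_bool (e \<notin> \<omega> \<and> B e \<omega>))"

definition f :: "nat \<Rightarrow> real" where
  "f k = expect p E (\<lambda>\<omega>. of_bool (T \<omega> = k))"

abbreviation N :: real where "N \<equiv> real (card E)"

lemma N_pos: "0 < N"
  using fin nonempty by (simp add: card_gt_0_iff)

lemma expect_mem_B:
  assumes "e \<in> E"
  shows "expect p E (\<lambda>\<omega>. of_bool (e \<in> \<omega> \<and> B e \<omega>)) = p * expect p E (\<lambda>\<omega>. of_bool (B e \<omega>))"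
  using expect_indep[of E "{e}" "\<lambda>\<omega>. of_bool (B e \<omega>)" p] assms fin
  by (simp add: B_indep of_bool_conj)

lemma expect_notmem_B:
  assumes "e \<in> E"
  shows "expect p E (\<lambda>\<omega>. of_bool (e \<notin> \<omega> \<and> B e \<omega>)) = (1 - p) * expect p E (\<lambda>\<omega>. of_bool (B e \<omega>))"
proof -
  have "expect p E (\<lambda>\<omega>. of_bool (e \<notin> \<omega> \<and> B e \<omega>))
      = expect p E (\<lambda>\<omega>. of_bool (B e \<omega>) - of_bool (e \<in> \<omega> \<and> B e \<omega>))"
    by (intro expect_cong) auto
  then show ?thesis by (simp add: expect_diff expect_mem_B[OF assms] algebra_simps)
qed

lemma expect_mem_B_pair:
  assumes "e \<in> E" "e' \<in> E" "e \<noteq> e'"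
  shows "expect p E (\<lambda>\<omega>. of_bool ((e \<in> \<omega> \<and> B e \<omega>) \<and> e' \<in> \<omega> \<and> B e' \<omega>)) \<le> p\<^sup>2 * (\<rho>\<^sup>2 * \<eta>)"
proof -
  have "expect p E (\<lambda>\<omega>. of_bool ((e \<in> \<omega> \<and> B e \<omega>) \<and> e' \<in> \<omega> \<and> B e' \<omega>))
      = expect p E (\<lambda>\<omega>. of_bool ({e, e'} \<subseteq> \<omega>) * of_bool (B e \<omega> \<and> B e' \<omega>))"
    by (intro expect_cong) auto
  also have "\<dots> \<le> expect p E (\<lambda>\<omega>. of_bool ({e, e'} \<subseteq> \<omega>)) * expect p E (\<lambda>\<omega>. of_bool (B e \<omega> \<and> B e' \<omega>))"
    using p by (intro harris_opposite[OF fin]) (auto dest: B_antimono)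
  also have "expect p E (\<lambda>\<omega>. of_bool ({e, e'} \<subseteq> \<omega>)) = p\<^sup>2"
    using expect_superset[OF fin, of "{e, e'}" p] assms by (simp add: power2_eq_square)
  also have "p\<^sup>2 * expect p E (\<lambda>\<omega>. of_bool (B e \<omega> \<and> B e' \<omega>)) \<le> p\<^sup>2 * (\<rho>\<^sup>2 * \<eta>)"
    using B_pair[OF assms] by (intro mult_left_mono) auto
  finally show ?thesis .
qed

section \<open>Concentration of the two flip counts\<close>

lemma second_moment_sum:
  fixes P :: "'a \<Rightarrow> 'a set \<Rightarrow> bool"
  assumes "\<And>e. e \<in> E \<Longrightarrow> expect p E (\<lambda>\<omega>. of_bool (P e \<omega>)) \<le> a"
    and "\<And>e e'. e \<in> E \<Longrightarrow> e' \<in> E \<Longrightarrow> e \<noteq> e' \<Longrightarrow> expect p E (\<lambda>\<omega>. of_bool (P e \<omega> \<and> P e' \<omega>)) \<le> b"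
    and "0 \<le> a" "0 \<le> b"
  shows "expect p E (\<lambda>\<omega>. (\<Sum>e\<in>E. of_bool (P e \<omega>))\<^sup>2) \<le> N * a + N\<^sup>2 * b"
proof -
  have "expect p E (\<lambda>\<omega>. (\<Sum>e\<in>E. of_bool (P e \<omega>))\<^sup>2)
      = (\<Sum>e\<in>E. \<Sum>e'\<in>E. expect p E (\<lambda>\<omega>. of_bool (P e \<omega> \<and> P e' \<omega>)))"
    by (simp add: power2_eq_square sum_product expect_sum of_bool_conj)
  also have "\<dots> \<le> (\<Sum>e\<in>E. \<Sum>e'\<in>E. (if e = e' then a else 0) + b)"
    using assms by (intro sum_mono) (auto intro: add_increasing2)
  also have "\<dots> = N * a + N\<^sup>2 * b"
    using fin by (simp add: sum.distrib power2_eq_square algebra_simps)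
  finally show ?thesis .
qed

text \<open>The centre is a lower bound for the mean rather than the mean. This suffices: the mean
  enters only through the cross term, with a negative sign.\<close>

lemma second_moment_X:
  "expect p E (\<lambda>\<omega>. (X \<omega> - N * p * \<rho>)\<^sup>2) \<le> (N * p * \<rho>) * \<eta> + (N * p * \<rho>)\<^sup>2 * (\<eta> - 1)"
proof -
  define M where "M = N * p * \<rho>"
  have M: "0 < M" unfolding M_def using N_pos p rho by simp
  have "expect p E X = (\<Sum>e\<in>E. p * expect p E (\<lambda>\<omega>. of_bool (B e \<omega>)))"
    unfolding X_def[abs_def] by (simp only: expect_sum) (auto intro: sum.cong expect_mem_B)
  also have "\<dots> \<ge> (\<Sum>e\<in>E. p * \<rho>)"
    using p by (intro sum_mono mult_left_mono B_lower) auto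
  finally have EX: "M \<le> expect p E X" by (simp add: M_def mult.assoc)
  have EX2: "expect p E (\<lambda>\<omega>. (X \<omega>)\<^sup>2) \<le> N * (p * (\<rho> * \<eta>)) + N\<^sup>2 * (p\<^sup>2 * (\<rho>\<^sup>2 * \<eta>))"
    unfolding X_def using p rho eta
    by (intro second_moment_sum expect_mem_B_pair) (auto simp: expect_mem_B intro!: mult_left_mono B_upper)
  have "expect p E (\<lambda>\<omega>. (X \<omega> - M)\<^sup>2) = expect p E (\<lambda>\<omega>. ((X \<omega>)\<^sup>2 - (2 * M) * X \<omega>) + M\<^sup>2)"
    by (intro expect_cong) (simp add: power2_eq_square algebra_simps)
  also have "\<dots> = expect p E (\<lambda>\<omega>. (X \<omega>)\<^sup>2) - (2 * M) * expect p E X + M\<^sup>2"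
    by (simp only: expect_add expect_diff expect_cmult expect_const[OF fin])
  also have "\<dots> \<le> (M * \<eta> + M\<^sup>2 * \<eta>) - (2 * M) * M + M\<^sup>2"
  proof -
    have "N * (p * (\<rho> * \<eta>)) + N\<^sup>2 * (p\<^sup>2 * (\<rho>\<^sup>2 * \<eta>)) = M * \<eta> + M\<^sup>2 * \<eta>"
      by (simp add: M_def power_mult_distrib algebra_simps)
    moreover have "(2 * M) * M \<le> (2 * M) * expect p E X" using EX M by (intro mult_left_mono) auto
    ultimately show ?thesis using EX2 by linarith
  qed
  finally show ?thesis unfolding M_def by (simp add: algebra_simps power2_eq_square)
qed

text \<open>The condition that \<open>e\<close> is absent is dropped for the second moment but costs
  a factor 1 - p in the mean; this is the source of the additional \<open>2 * p\<close>.\<close>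

lemma second_moment_Z:
  "expect p E (\<lambda>\<omega>. (Z \<omega> - N * \<rho>)\<^sup>2) \<le> (N * \<rho>) * \<eta> + (N * \<rho>)\<^sup>2 * (\<eta> - 1 + 2 * p)"
proof -
  define M where "M = N * \<rho>"
  have M: "0 < M" unfolding M_def using N_pos p rho by simp
  have "expect p E Z = (\<Sum>e\<in>E. (1 - p) * expect p E (\<lambda>\<omega>. of_bool (B e \<omega>)))"
    unfolding Z_def[abs_def] by (simp only: expect_sum) (auto intro: sum.cong expect_notmem_B)
  also have "\<dots> \<ge> (\<Sum>e\<in>E. (1 - p) * \<rho>)"
    using p by (intro sum_mono mult_left_mono B_lower) auto
  finally have EZ: "(1 - p) * M \<le> expect p E Z" by (simp add: M_def mult.assoc mult.left_commute)
  have EZ2: "expect p E (\<lambda>\<omega>. (Z \<omega>)\<^sup>2) \<le> N * (\<rho> * \<eta>) + N\<^sup>2 * (\<rho>\<^sup>2 * \<eta>)"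
    unfolding Z_def
  proof (intro second_moment_sum)
    fix e assume "e \<in> E"
    have "expect p E (\<lambda>\<omega>. of_bool (e \<notin> \<omega> \<and> B e \<omega>)) \<le> expect p E (\<lambda>\<omega>. of_bool (B e \<omega>))"
      using p by (intro expect_mono) auto
    then show "expect p E (\<lambda>\<omega>. of_bool (e \<notin> \<omega> \<and> B e \<omega>)) \<le> \<rho> * \<eta>"
      using B_upper[OF \<open>e \<in> E\<close>] by linarith
  next
    fix e e' assume e: "e \<in> E" "e' \<in> E" "e \<noteq> e'"
    have "expect p E (\<lambda>\<omega>. of_bool ((e \<notin> \<omega> \<and> B e \<omega>) \<and> e' \<notin> \<omega> \<and> B e' \<omega>))
        \<le> expect p E (\<lambda>\<omega>. of_bool (B e \<omega> \<and> B e' \<omega>))"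
      using p by (intro expect_mono) auto
    then show "expect p E (\<lambda>\<omega>. of_bool ((e \<notin> \<omega> \<and> B e \<omega>) \<and> e' \<notin> \<omega> \<and> B e' \<omega>)) \<le> \<rho>\<^sup>2 * \<eta>"
      using B_pair[OF e] by linarith
  qed (use rho eta in auto)
  have "expect p E (\<lambda>\<omega>. (Z \<omega> - M)\<^sup>2) = expect p E (\<lambda>\<omega>. ((Z \<omega>)\<^sup>2 - (2 * M) * Z \<omega>) + M\<^sup>2)"
    by (intro expect_cong) (simp add: power2_eq_square algebra_simps)
  also have "\<dots> = expect p E (\<lambda>\<omega>. (Z \<omega>)\<^sup>2) - (2 * M) * expect p E Z + M\<^sup>2"
    by (simp only: expect_add expect_diff expect_cmult expect_const[OF fin])
  also have "\<dots> \<le> (M * \<eta> + M\<^sup>2 * \<eta>) - (2 * M) * ((1 - p) * M) + M\<^sup>2"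
  proof -
    have "N * (\<rho> * \<eta>) + N\<^sup>2 * (\<rho>\<^sup>2 * \<eta>) = M * \<eta> + M\<^sup>2 * \<eta>"
      by (simp add: M_def power_mult_distrib algebra_simps)
    moreover have "(2 * M) * ((1 - p) * M) \<le> (2 * M) * expect p E Z" using EZ M by (intro mult_left_mono) auto
    ultimately show ?thesis using EZ2 by linarith
  qed
  finally show ?thesis unfolding M_def by (simp add: algebra_simps power2_eq_square)
qed

text \<open>\<open>M0\<close> is separate from the centre \<open>M\<close> so that one relative
  error serves both \<open>X\<close> and \<open>Z\<close>: the centre of \<open>Z\<close> is the
  larger one, by the factor 1/p.\<close>

lemma relative_deviation:
  assumes "0 < M" "M0 \<le> M" "0 < M0"
    and "expect p E (\<lambda>\<omega>. (Y \<omega> - M)\<^sup>2) \<le> M * \<eta> + M\<^sup>2 * c"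
  shows "expect p E (\<lambda>\<omega>. \<bar>Y \<omega> - M\<bar>) \<le> M * sqrt (\<eta> / M0 + c)"
proof -
  have "expect p E (\<lambda>\<omega>. \<bar>Y \<omega> - M\<bar>) \<le> sqrt (expect p E (\<lambda>\<omega>. (Y \<omega> - M)\<^sup>2))"
    using p by (intro expect_abs_le_sqrt fin) auto
  also have "\<dots> \<le> sqrt (M\<^sup>2 * (\<eta> / M0 + c))"
  proof (rule real_sqrt_le_mono)
    have "M * \<eta> = M\<^sup>2 * (\<eta> / M)" using assms by (simp add: power2_eq_square)
    also have "\<dots> \<le> M\<^sup>2 * (\<eta> / M0)" using assms eta by (intro mult_left_mono divide_left_mono) auto
    finally show "expect p E (\<lambda>\<omega>. (Y \<omega> - M)\<^sup>2) \<le> M\<^sup>2 * (\<eta> / M0 + c)"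
      using assms by (simp add: algebra_simps)
  qed
  also have "\<dots> = M * sqrt (\<eta> / M0 + c)" using assms by (simp add: real_sqrt_mult)
  finally show ?thesis .
qed

section \<open>The exchange identity and its iteration over consecutive values\<close>

lemma exchange:
  "(1 - p) * expect p E (\<lambda>\<omega>. of_bool (T \<omega> = Suc k) * X \<omega>) = p * expect p E (\<lambda>\<omega>. of_bool (T \<omega> = k) * Z \<omega>)"
proof -
  \<comment> \<open>Once the coordinate \<open>e\<close> is exposed, both sides are p (1 - p) times
    the same expectation over \<open>E'\<close>, that of \<open>T \<omega> = k\<close> together with
    \<open>B e \<omega>\<close>.\<close>
  have flip: "(1 - p) * expect p E (\<lambda>\<omega>. of_bool (T \<omega> = Suc k) * of_bool (e \<in> \<omega> \<and> B e \<omega>))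
      = p * expect p E (\<lambda>\<omega>. of_bool (T \<omega> = k) * of_bool (e \<notin> \<omega> \<and> B e \<omega>))" if "e \<in> E" for e
  proof -
    define E' where "E' = E - {e}"
    have E: "E = insert e E'" "e \<notin> E'" "finite E'" using that fin by (auto simp: E'_def)
    have Be: "B e (insert e \<omega>) = B e \<omega>" if "\<omega> \<subseteq> E'" for \<omega>
    proof -
      have "insert e \<omega> - {e} = \<omega>" using that E by auto
      then show ?thesis using B_indep[of e "insert e \<omega>"] by simp
    qed
    have Te: "T (insert e \<omega>) = Suc (T \<omega>)" if "\<omega> \<subseteq> E'" "B e \<omega>" for \<omega>
      using that E by (intro T_flip) auto
    have "expect p E (\<lambda>\<omega>. of_bool (T \<omega> = Suc k) * of_bool (e \<in> \<omega> \<and> B e \<omega>))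
        = p * expect p E' (\<lambda>\<omega>. of_bool (T (insert e \<omega>) = Suc k) * of_bool (B e (insert e \<omega>)))
          + (1 - p) * expect p E' (\<lambda>\<omega>. of_bool (T \<omega> = Suc k) * of_bool (e \<in> \<omega> \<and> B e \<omega>))"
      unfolding E(1) using E by (subst expect_insert) auto
    also have "expect p E' (\<lambda>\<omega>. of_bool (T (insert e \<omega>) = Suc k) * of_bool (B e (insert e \<omega>)))
        = expect p E' (\<lambda>\<omega>. of_bool (T \<omega> = k) * of_bool (B e \<omega>))"
      by (intro expect_cong) (auto simp: Be Te)
    also have "expect p E' (\<lambda>\<omega>. of_bool (T \<omega> = Suc k) * of_bool (e \<in> \<omega> \<and> B e \<omega>)) = expect p E' (\<lambda>_. 0)"
      using E by (intro expect_cong) auto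
    finally have 1: "expect p E (\<lambda>\<omega>. of_bool (T \<omega> = Suc k) * of_bool (e \<in> \<omega> \<and> B e \<omega>))
        = p * expect p E' (\<lambda>\<omega>. of_bool (T \<omega> = k) * of_bool (B e \<omega>))"
      using E by (simp add: expect_const)
    have "expect p E (\<lambda>\<omega>. of_bool (T \<omega> = k) * of_bool (e \<notin> \<omega> \<and> B e \<omega>))
        = p * expect p E' (\<lambda>\<omega>. 0)
          + (1 - p) * expect p E' (\<lambda>\<omega>. of_bool (T \<omega> = k) * of_bool (e \<notin> \<omega> \<and> B e \<omega>))"
      unfolding E(1) using E by (subst expect_insert) auto
    also have "expect p E' (\<lambda>\<omega>. of_bool (T \<omega> = k) * of_bool (e \<notin> \<omega> \<and> B e \<omega>))
        = expect p E' (\<lambda>\<omega>. of_bool (T \<omega> = k) * of_bool (B e \<omega>))"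
      using E by (intro expect_cong) auto
    finally show ?thesis using 1 E by (simp add: expect_const)
  qed
  have "(1 - p) * expect p E (\<lambda>\<omega>. of_bool (T \<omega> = Suc k) * X \<omega>)
      = (\<Sum>e\<in>E. (1 - p) * expect p E (\<lambda>\<omega>. of_bool (T \<omega> = Suc k) * of_bool (e \<in> \<omega> \<and> B e \<omega>)))"
    unfolding X_def by (simp only: sum_distrib_left expect_sum)
  also have "\<dots> = (\<Sum>e\<in>E. p * expect p E (\<lambda>\<omega>. of_bool (T \<omega> = k) * of_bool (e \<notin> \<omega> \<and> B e \<omega>)))"
    by (intro sum.cong refl flip)
  also have "\<dots> = p * expect p E (\<lambda>\<omega>. of_bool (T \<omega> = k) * Z \<omega>)"
    unfolding Z_def by (simp only: sum_distrib_left expect_sum)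
  finally show ?thesis .
qed

text \<open>Twice a relative deviation: one share is lost when \<open>Z\<close> is replaced by its
  centre, the other when \<open>X\<close> is.\<close>

definition \<delta> :: real where
  "\<delta> = 2 * sqrt (\<eta> / (N * p * \<rho>) + (\<eta> - 1 + 2 * p))"

text \<open>In the exchange identity, \<open>Z\<close> and \<open>X\<close> are replaced by their
  centres \<open>MZ\<close> and \<open>MX\<close>. Since \<open>MX = p * MZ\<close>, division by
  \<open>MX\<close> leaves a comparison of two probabilities; the factor 1 - p is bounded by
  1.\<close>

lemma f_Suc: "f k \<le> f (Suc k) + \<delta>"
proof -
  define MX MZ where "MX = N * p * \<rho>" and "MZ = N * \<rho>"
  define d where "d = sqrt (\<eta> / MX + (\<eta> - 1 + 2 * p))"
  have MX: "0 < MX" "MX \<le> MZ" "0 < MZ" "MX = p * MZ"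
    using N_pos p rho by (auto simp: MX_def MZ_def)
  have dX: "expect p E (\<lambda>\<omega>. \<bar>X \<omega> - MX\<bar>) \<le> MX * d"
    unfolding d_def
  proof (rule relative_deviation)
    have "MX * \<eta> + MX\<^sup>2 * (\<eta> - 1) \<le> MX * \<eta> + MX\<^sup>2 * (\<eta> - 1 + 2 * p)"
      using p by (intro add_left_mono mult_left_mono) auto
    then show "expect p E (\<lambda>\<omega>. (X \<omega> - MX)\<^sup>2) \<le> MX * \<eta> + MX\<^sup>2 * (\<eta> - 1 + 2 * p)"
      using second_moment_X by (simp add: MX_def)
  qed (use MX in auto)
  have dZ: "expect p E (\<lambda>\<omega>. \<bar>Z \<omega> - MZ\<bar>) \<le> MZ * d"
    unfolding d_def using second_moment_Z MX by (intro relative_deviation) (auto simp: MZ_def)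
  have "MZ * f k = expect p E (\<lambda>\<omega>. MZ * of_bool (T \<omega> = k))"
    by (simp only: f_def expect_cmult)
  also have "\<dots> \<le> expect p E (\<lambda>\<omega>. of_bool (T \<omega> = k) * Z \<omega> + \<bar>Z \<omega> - MZ\<bar>)"
    using p by (intro expect_mono) auto
  also have "\<dots> \<le> expect p E (\<lambda>\<omega>. of_bool (T \<omega> = k) * Z \<omega>) + MZ * d"
    using dZ by (simp add: expect_add)
  finally have "p * (MZ * f k) \<le> p * (expect p E (\<lambda>\<omega>. of_bool (T \<omega> = k) * Z \<omega>) + MZ * d)"
    using p by (intro mult_left_mono) auto
  then have 1: "MX * f k \<le> (1 - p) * expect p E (\<lambda>\<omega>. of_bool (T \<omega> = Suc k) * X \<omega>) + MX * d"
    using MX(4) by (simp add: exchange distrib_left mult.assoc)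
  have "expect p E (\<lambda>\<omega>. of_bool (T \<omega> = Suc k) * X \<omega>)
      \<le> expect p E (\<lambda>\<omega>. MX * of_bool (T \<omega> = Suc k) + \<bar>X \<omega> - MX\<bar>)"
    using p by (intro expect_mono) auto
  also have "\<dots> = MX * f (Suc k) + expect p E (\<lambda>\<omega>. \<bar>X \<omega> - MX\<bar>)"
    by (simp only: expect_add expect_cmult f_def)
  finally have 2: "expect p E (\<lambda>\<omega>. of_bool (T \<omega> = Suc k) * X \<omega>) \<le> MX * f (Suc k) + MX * d"
    using dX by linarith
  have 3: "0 \<le> expect p E (\<lambda>\<omega>. of_bool (T \<omega> = Suc k) * X \<omega>)"
    using p by (intro expect_nonneg mult_nonneg_nonneg) (auto simp: X_def intro: sum_nonneg)
  have "(1 - p) * expect p E (\<lambda>\<omega>. of_bool (T \<omega> = Suc k) * X \<omega>) \<le> MX * f (Suc k) + MX * d"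
    using 2 3 p mult_left_le_one_le[of "expect p E (\<lambda>\<omega>. of_bool (T \<omega> = Suc k) * X \<omega>)" "1 - p"] by linarith
  with 1 have "MX * f k \<le> MX * (f (Suc k) + 2 * d)"
    by (simp add: algebra_simps)
  then have "f k \<le> f (Suc k) + 2 * d" using MX(1) by (simp only: mult_le_cancel_left_pos)
  then show ?thesis by (simp only: \<delta>_def d_def MX_def)
qed

lemma f_add: "f k \<le> f (k + j) + real j * \<delta>"
proof (induction j)
  case (Suc j)
  then show ?case using f_Suc[of "k + j"] by (simp add: algebra_simps)
qed simp

text \<open>The values k, ..., k + J - 1 are attained on disjoint events, each of probability at
  least \<open>f k - real J * \<delta>\<close>, and these probabilities add up to at most 1.\<close>

lemma anticoncentration: "real J * f k \<le> 1 + (real J)\<^sup>2 * \<delta>"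
proof -
  have \<delta>0: "0 \<le> \<delta>"
    unfolding \<delta>_def using N_pos p rho eta by (intro mult_nonneg_nonneg real_sqrt_ge_zero add_nonneg_nonneg) auto
  have "real J * f k = (\<Sum>j<J. f k)" by simp
  also have "\<dots> \<le> (\<Sum>j<J. f (k + j) + real J * \<delta>)"
  proof (rule sum_mono)
    fix j assume "j \<in> {..<J}"
    then have "real j * \<delta> \<le> real J * \<delta>" using \<delta>0 by (intro mult_right_mono) auto
    then show "f k \<le> f (k + j) + real J * \<delta>" using f_add[of k j] by linarith
  qed
  also have "\<dots> = expect p E (\<lambda>\<omega>. \<Sum>j<J. of_bool (T \<omega> = k + j)) + (real J)\<^sup>2 * \<delta>"
    by (simp only: sum.distrib f_def expect_sum) (simp add: power2_eq_square)
  also have "expect p E (\<lambda>\<omega>. \<Sum>j<J. of_bool (T \<omega> = k + j)) \<le> expect p E (\<lambda>_. 1)"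
  proof (rule expect_mono)
    fix \<omega>
    \<comment> \<open>Truncated subtraction gives index 0 when \<open>T \<omega>\<close> is below
      \<open>k\<close>; the left side then vanishes, so the inequality still holds.\<close>
    have "(\<Sum>j<J. of_bool (T \<omega> = k + j)) \<le> (\<Sum>j<J. if j = T \<omega> - k then 1 else 0 :: real)"
      by (intro sum_mono) auto
    also have "\<dots> \<le> 1" by simp
    finally show "(\<Sum>j<J. of_bool (T \<omega> = k + j)) \<le> (1 :: real)" .
  qed (use p in auto)
  finally show ?thesis by (simp add: expect_const fin)
qed

end

section \<open>Weak saturation numbers\<close>

lemma simple_graph_finite_edges: "simple_graph G \<Longrightarrow> finite (edges G)"
  unfolding simple_graph_def all_pairs_def
  by (rule finite_subset[of _ "Pow (verts G)"]) auto

lemma bootstrap_step_simple: "bootstrap_step F H H' \<Longrightarrow> simple_graph H \<Longrightarrow> simple_graph H'"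
  by (auto simp: bootstrap_step_def simple_graph_def)

text \<open>The closure form gives rule induction along a process. Steps preserve simplicity, so it
  has to be recorded for the initial graph only.\<close>

lemma bootstrap_process_iff_rtranclp:
  "(\<exists>m Hs. bootstrap_process F m Hs \<and> Hs 0 = H \<and> Hs m = G)
    \<longleftrightarrow> simple_graph H \<and> (bootstrap_step F)\<^sup>*\<^sup>* H G" (is "?L \<longleftrightarrow> ?R")
proof
  assume ?L
  then obtain m Hs where m: "bootstrap_process F m Hs" "Hs 0 = H" "Hs m = G" by blast
  have "i \<le> m \<Longrightarrow> (bootstrap_step F)\<^sup>*\<^sup>* H (Hs i)" for i
  proof (induction i)
    case 0
    then show ?case using m by simp
  next
    case (Suc i)
    then have "bootstrap_step F (Hs i) (Hs (Suc i))"
      using m(1) unfolding bootstrap_process_def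
      by (metis atLeastAtMost_iff diff_Suc_1 le_add1 plus_1_eq_Suc)
    then show ?case using Suc by (meson Suc_leD rtranclp.simps)
  qed
  then show ?R using m by (auto simp: bootstrap_process_def)
next
  assume R: ?R
  then have "(bootstrap_step F)\<^sup>*\<^sup>* H G" "simple_graph H" by auto
  then obtain m where "(bootstrap_step F ^^ m) H G"
    using rtranclp_imp_relpowp by metis
  then obtain Hs where Hs: "Hs 0 = H" "Hs m = G" "\<And>i. i < m \<Longrightarrow> bootstrap_step F (Hs i) (Hs (Suc i))"
    by (auto simp: relpowp_fun_conv)
  have "i \<le> m \<Longrightarrow> simple_graph (Hs i)" for i
    by (induction i) (use Hs \<open>simple_graph H\<close> bootstrap_step_simple in \<open>auto simp: Suc_le_eq\<close>)
  moreover have "bootstrap_step F (Hs (i - 1)) (Hs i)" if "i \<in> {1..m}" for i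
    using Hs(3)[of "i - 1"] that by auto
  ultimately show ?L using Hs unfolding bootstrap_process_def by blast
qed

lemma bootstrap_steps_mono:
  assumes "(bootstrap_step F)\<^sup>*\<^sup>* H G"
  shows "verts H = verts G \<and> edges H \<subseteq> edges G"
  using assms by (induction rule: rtranclp_induct) (auto simp: bootstrap_step_def)

lemma weakly_saturated_iff:
  "weakly_saturated G F H \<longleftrightarrow>
    simple_graph H \<and> (\<nexists>C. copy_in C F H) \<and> (bootstrap_step F)\<^sup>*\<^sup>* H G"
  unfolding weakly_saturated_def bootstrap_process_iff_rtranclp
  using bootstrap_steps_mono[of F H G]
  by (auto simp: spanning_subgraph_def subgraph_def)

lemma copy_in_mono:
  assumes "copy_in C F H" "verts H \<subseteq> verts G" "edges H \<subseteq> edges G"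
  shows "copy_in C F G"
  using assms unfolding copy_in_def subgraph_def by blast

lemma copy_in_edge_free:
  assumes "copy_in C F G" "e \<notin> edges C" "verts G = verts H" "edges G \<subseteq> insert e (edges H)"
  shows "copy_in C F H"
  using assms unfolding copy_in_def subgraph_def by auto

lemma copy_has_edge:
  assumes "copy_in C F G" "edges F \<noteq> {}"
  shows "\<exists>e. e \<in> edges C"
  using assms by (auto simp: copy_in_def isomorphic_def)

text \<open>Deleting an edge that lies in a copy of \<open>F\<close> is the reverse of a bootstrap
  step; induction on the number of edges continues until no copy is left. Without existence the
  \<open>LEAST\<close> in \<open>wsat\<close> would carry no information.\<close>

lemma weakly_saturated_exists:
  assumes "simple_graph G" "edges F \<noteq> {}"
  shows "\<exists>H. weakly_saturated G F H"
  using assms(1)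
proof (induction "card (edges G)" arbitrary: G rule: less_induct)
  case less
  show ?case
  proof (cases "\<exists>C. copy_in C F G")
    case False
    then have "weakly_saturated G F G" using less by (simp add: weakly_saturated_iff)
    then show ?thesis ..
  next
    case True
    then obtain C e where C: "copy_in C F G" "e \<in> edges C"
      using copy_has_edge assms(2) by blast
    then have e: "e \<in> edges G" by (auto simp: copy_in_def subgraph_def)
    define G' where "G' = Graph (verts G) (edges G - {e})"
    have "card (edges G') < card (edges G)"
      using card_Diff1_less[OF simple_graph_finite_edges[OF less.prems] e] by (simp add: G'_def)
    moreover have "simple_graph G'" using less.prems by (auto simp: G'_def simple_graph_def)
    ultimately obtain H where H: "weakly_saturated G' F H" using less.hyps by blast
    have "G = Graph (verts G) (insert e (edges G'))"
      using e by (cases G) (auto simp: G'_def)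
    then have "bootstrap_step F G' G"
      unfolding bootstrap_step_def using C e less.prems
      by (intro exI[of _ e]) (auto simp: G'_def simple_graph_def)
    then have "weakly_saturated G F H"
      using H by (auto simp: weakly_saturated_iff intro: rtranclp.rtrancl_into_rtrancl)
    then show ?thesis ..
  qed
qed

lemma wsat_attained:
  assumes "simple_graph G" "edges F \<noteq> {}"
  shows "\<exists>H. weakly_saturated G F H \<and> card (edges H) = wsat G F"
proof -
  have "\<exists>k H. weakly_saturated G F H \<and> card (edges H) = k"
    using weakly_saturated_exists[OF assms] by blast
  from LeastI_ex[OF this] show ?thesis by (simp only: wsat_def)
qed

lemma wsat_le: "weakly_saturated G F H \<Longrightarrow> wsat G F \<le> card (edges H)"
  unfolding wsat_def by (rule Least_le) blast

lemma wsat_le_card_edges: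
  assumes "simple_graph G" "edges F \<noteq> {}"
  shows "wsat G F \<le> card (edges G)"
proof -
  obtain H where H: "weakly_saturated G F H" using weakly_saturated_exists[OF assms] ..
  then have "edges H \<subseteq> edges G"
    using bootstrap_steps_mono[of F H G] by (auto simp: weakly_saturated_iff)
  then show ?thesis
    using wsat_le[OF H] simple_graph_finite_edges[OF assms(1)] by (meson card_mono le_trans)
qed

section \<open>The effect of one added edge on the weak saturation number\<close>

definition add_edge :: "'a set \<Rightarrow> 'a graph \<Rightarrow> 'a graph" where
  "add_edge e G = Graph (verts G) (insert e (edges G))"

definition del_edge :: "'a set \<Rightarrow> 'a graph \<Rightarrow> 'a graph" where
  "del_edge e G = Graph (verts G) (edges G - {e})"

text \<open>Since \<open>e\<close> is absent from the final graph, it differs from every edge added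
  on the way, so each step remains a genuine step when \<open>e\<close> is present
  throughout.\<close>

lemma bootstrap_steps_add_edge:
  assumes "(bootstrap_step F)\<^sup>*\<^sup>* H G" "e \<notin> edges G"
  shows "(bootstrap_step F)\<^sup>*\<^sup>* (add_edge e H) (add_edge e G)"
  using assms
proof (induction rule: rtranclp_induct)
  case base
  then show ?case by simp
next
  case (step G1 G2)
  then obtain a C where a: "a \<in> all_pairs (verts G1)" "a \<notin> edges G1"
      "G2 = Graph (verts G1) (insert a (edges G1))" "copy_in C F G2" "a \<in> edges C"
    unfolding bootstrap_step_def by blast
  have "bootstrap_step F (add_edge e G1) (add_edge e G2)"
    unfolding bootstrap_step_def
  proof (intro exI[of _ a] conjI exI[of _ C])
    show "copy_in C F (add_edge e G2)"
      by (rule copy_in_mono[OF a(4)]) (auto simp: add_edge_def)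
  qed (use a step.prems in \<open>auto simp: add_edge_def\<close>)
  moreover have "(bootstrap_step F)\<^sup>*\<^sup>* (add_edge e H) (add_edge e G1)"
    using step a by auto
  ultimately show ?case by simp
qed

text \<open>An edge in no copy of \<open>F\<close> in the final graph is in none in any earlier
  graph. Hence it can neither be added by a step nor take part in the copy that justifies
  one.\<close>

lemma bootstrap_steps_del_edge:
  assumes "(bootstrap_step F)\<^sup>*\<^sup>* H G" "e \<in> edges G" "\<And>C. copy_in C F G \<Longrightarrow> e \<notin> edges C"
  shows "e \<in> edges H \<and> (bootstrap_step F)\<^sup>*\<^sup>* (del_edge e H) (del_edge e G)"
  using assms
proof (induction rule: rtranclp_induct)
  case base
  then show ?case by simp
next
  case (step G1 G2)
  then obtain a C where a: "a \<in> all_pairs (verts G1)" "a \<notin> edges G1"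
      "G2 = Graph (verts G1) (insert a (edges G1))" "copy_in C F G2" "a \<in> edges C"
    unfolding bootstrap_step_def by blast
  have C: "e \<notin> edges C" using a(4) step.prems by blast
  \<comment> \<open>The new edge \<open>a\<close> lies in \<open>C\<close> and \<open>e\<close> does
    not, so \<open>e\<close> is not the edge just added.\<close>
  then have "e \<in> edges G1" using step.prems a by auto
  moreover have "e \<notin> edges C'" if "copy_in C' F G1" for C'
    using step.prems(2) copy_in_mono[OF that, of G2] a(3) by auto
  ultimately have IH: "e \<in> edges H \<and> (bootstrap_step F)\<^sup>*\<^sup>* (del_edge e H) (del_edge e G1)"
    using step.IH by blast
  have "bootstrap_step F (del_edge e G1) (del_edge e G2)"
    unfolding bootstrap_step_def
  proof (intro exI[of _ a] conjI exI[of _ C])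
    show "copy_in C F (del_edge e G2)"
      by (rule copy_in_edge_free[OF a(4) C]) (auto simp: del_edge_def)
  qed (use a C \<open>e \<in> edges G1\<close> in \<open>auto simp: del_edge_def\<close>)
  then show ?case using IH by auto
qed

text \<open>Inserting \<open>e\<close> into an optimal subgraph for \<open>G\<close> creates no copy
  of \<open>F\<close>, which gives one inequality; an optimal subgraph for
  \<open>add_edge e G\<close> must contain \<open>e\<close>, and removing it gives the
  other.\<close>

lemma wsat_add_edge:
  assumes G: "simple_graph G" and F: "edges F \<noteq> {}"
    and e: "e \<in> all_pairs (verts G)" "e \<notin> edges G"
    and free: "\<And>C. copy_in C F (add_edge e G) \<Longrightarrow> e \<notin> edges C"
  shows "wsat (add_edge e G) F = Suc (wsat G F)"
proof (rule antisym)
  obtain H where H: "weakly_saturated G F H" "card (edges H) = wsat G F"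
    using wsat_attained[OF G F] by blast
  have HG: "verts H = verts G" "edges H \<subseteq> edges G"
    using H(1) bootstrap_steps_mono[of F H G] by (auto simp: weakly_saturated_iff)
  have "\<nexists>C. copy_in C F (add_edge e H)"
  proof
    assume "\<exists>C. copy_in C F (add_edge e H)"
    then obtain C where C: "copy_in C F (add_edge e H)" ..
    have "copy_in C F (add_edge e G)"
      by (rule copy_in_mono[OF C]) (use HG in \<open>auto simp: add_edge_def\<close>)
    from copy_in_edge_free[OF C free[OF this], of H] have "copy_in C F H"
      by (simp add: add_edge_def)
    then show False using H(1) by (auto simp: weakly_saturated_iff)
  qed
  then have "weakly_saturated (add_edge e G) F (add_edge e H)"
    using H(1) e HG bootstrap_steps_add_edge[of F H G e]
    by (auto simp: weakly_saturated_iff simple_graph_def add_edge_def)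
  then have "wsat (add_edge e G) F \<le> card (edges (add_edge e H))" by (rule wsat_le)
  also have "\<dots> \<le> Suc (card (edges H))"
    using HG simple_graph_finite_edges[OF G] by (simp add: add_edge_def card_insert_le_m1 card_insert_if finite_subset)
  finally show "wsat (add_edge e G) F \<le> Suc (wsat G F)" using H by simp
next
  have "simple_graph (add_edge e G)" using G e by (auto simp: simple_graph_def add_edge_def)
  then obtain H where H: "weakly_saturated (add_edge e G) F H" "card (edges H) = wsat (add_edge e G) F"
    using wsat_attained F by blast
  have del: "del_edge e (add_edge e G) = G"
    using e(2) by (cases G) (auto simp: del_edge_def add_edge_def)
  have *: "e \<in> edges H" "(bootstrap_step F)\<^sup>*\<^sup>* (del_edge e H) G"
    using bootstrap_steps_del_edge[of F H "add_edge e G" e] H(1) free del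
    by (auto simp: weakly_saturated_iff add_edge_def)
  have "\<nexists>C. copy_in C F (del_edge e H)"
    using H(1) copy_in_mono[of _ F "del_edge e H" H] by (auto simp: weakly_saturated_iff del_edge_def)
  moreover have "simple_graph (del_edge e H)"
    using H(1) by (auto simp: weakly_saturated_iff del_edge_def simple_graph_def)
  ultimately have "weakly_saturated G F (del_edge e H)"
    using * by (auto simp: weakly_saturated_iff)
  then have "wsat G F \<le> card (edges (del_edge e H))" by (rule wsat_le)
  also have "Suc \<dots> = card (edges H)"
    using * H(1) simple_graph_finite_edges[of H]
    by (simp add: del_edge_def weakly_saturated_iff card_Suc_Diff1 del: card_Diff_insert)
  finally show "Suc (wsat G F) \<le> wsat (add_edge e G) F" using H by simp
qed

section \<open>Copies of a complete graph as vertex sets\<close>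

lemma complete_graph_edges_nonempty:
  assumes "s \<ge> 2"
  shows "edges (complete_graph s) \<noteq> {}"
proof -
  have "{1, 2} \<in> edges (complete_graph s)"
    using assms by (auto simp: complete_graph_def all_pairs_def)
  then show ?thesis by blast
qed

lemma copy_of_complete_graph:
  assumes "copy_in C (complete_graph s) G"
  shows "verts C \<subseteq> verts G \<and> card (verts C) = s \<and> edges C = all_pairs (verts C) \<and> edges C \<subseteq> edges G"
proof -
  obtain f where f: "bij_betw f {1..s} (verts C)" "edges C = (`) f ` all_pairs {1..s}"
    using assms by (auto simp: copy_in_def isomorphic_def complete_graph_def)
  have inj: "inj_on f {1..s}" and im: "f ` {1..s} = verts C" using f by (auto simp: bij_betw_def)
  have "(`) f ` all_pairs {1..s} = all_pairs (verts C)"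
  proof (intro equalityI subsetI)
    fix x assume "x \<in> (`) f ` all_pairs {1..s}"
    then obtain e where "e \<subseteq> {1..s}" "card e = 2" "x = f ` e" by (auto simp: all_pairs_def)
    then show "x \<in> all_pairs (verts C)"
      using im card_image[OF inj_on_subset[OF inj]] by (auto simp: all_pairs_def)
  next
    fix x assume x: "x \<in> all_pairs (verts C)"
    then obtain e where e: "e \<subseteq> {1..s}" "x = f ` e"
      using im unfolding all_pairs_def by (metis (lifting) mem_Collect_eq subset_image_iff)
    then have "card e = 2"
      using x card_image[OF inj_on_subset[OF inj e(1)]] by (auto simp: all_pairs_def)
    then show "x \<in> (`) f ` all_pairs {1..s}" using e by (auto simp: all_pairs_def)
  qed
  then show ?thesis
    using f assms bij_betw_same_card[OF f(1)] by (auto simp: copy_in_def subgraph_def)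
qed

section \<open>Overlapping cliques\<close>

definition cliques_through :: "'a set \<Rightarrow> nat \<Rightarrow> 'a set \<Rightarrow> 'a set set" where
  "cliques_through V s e = {S. e \<subseteq> S \<and> S \<subseteq> V \<and> card S = s}"

text \<open>The pairs that a clique on \<open>snd i\<close> needs besides \<open>fst i\<close>.
  Leaving \<open>fst i\<close> out makes the event independent of whether this pair is an edge, as a
  flip requires.\<close>

definition clique_rest :: "'a set \<times> 'a set \<Rightarrow> 'a set set" where
  "clique_rest i = all_pairs (snd i) - {fst i}"

text \<open>A singleton \<open>Q\<close> serves the first moment, a set of two pairs the second:
  avoiding the cliques through both is one avoidance event.\<close>

abbreviation rest_index :: "'a set \<Rightarrow> nat \<Rightarrow> 'a set set \<Rightarrow> ('a set \<times> 'a set) set" where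
  "rest_index V s Q \<equiv> Sigma Q (cliques_through V s)"

lemma finite_all_pairs: "finite V \<Longrightarrow> finite (all_pairs V)"
  unfolding all_pairs_def by (rule finite_subset[of _ "Pow V"]) auto

lemma card_all_pairs: "finite V \<Longrightarrow> card (all_pairs V) = card V choose 2"
  unfolding all_pairs_def by (rule n_subsets)

lemma finite_cliques_through: "finite V \<Longrightarrow> finite (cliques_through V s e)"
  unfolding cliques_through_def by (rule finite_subset[of _ "Pow V"]) auto

lemma card_cliques_through:
  assumes "finite V" "e \<in> all_pairs V" "2 \<le> s"
  shows "card (cliques_through V s e) = (card V - 2) choose (s - 2)"
proof -
  have e: "e \<subseteq> V" "card e = 2" "finite e"
    using assms finite_subset by (auto simp: all_pairs_def)
  have "bij_betw (\<lambda>S. S - e) (cliques_through V s e) {Y. Y \<subseteq> V - e \<and> card Y = s - 2}"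
  proof (rule bij_betwI[where g = "\<lambda>Y. Y \<union> e"])
    show "(\<lambda>S. S - e) \<in> cliques_through V s e \<rightarrow> {Y. Y \<subseteq> V - e \<and> card Y = s - 2}"
      using e by (auto simp: cliques_through_def card_Diff_subset)
    show "(\<lambda>Y. Y \<union> e) \<in> {Y. Y \<subseteq> V - e \<and> card Y = s - 2} \<rightarrow> cliques_through V s e"
    proof
      fix Y assume Y: "Y \<in> {Y. Y \<subseteq> V - e \<and> card Y = s - 2}"
      then have "card (Y \<union> e) = s - 2 + 2"
        using e assms(1) finite_subset[of Y V] by (subst card_Un_disjoint) auto
      then show "Y \<union> e \<in> cliques_through V s e" using Y e assms(3) by (auto simp: cliques_through_def)
    qed
  qed (auto simp: cliques_through_def)
  then have "card (cliques_through V s e) = card {Y. Y \<subseteq> V - e \<and> card Y = s - 2}"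
    by (rule bij_betw_same_card)
  also have "\<dots> = card (V - e) choose (s - 2)" using assms(1) by (intro n_subsets) auto
  also have "card (V - e) = card V - 2" using e by (simp add: card_Diff_subset)
  finally show ?thesis .
qed

lemma clique_rest_props:
  assumes "finite V" "e \<in> all_pairs V" "S \<in> cliques_through V s e"
  shows "clique_rest (e, S) \<subseteq> all_pairs V" "card (clique_rest (e, S)) = (s choose 2) - 1"
proof -
  have S: "e \<subseteq> S" "S \<subseteq> V" "card S = s" "finite S"
    using assms finite_subset by (auto simp: cliques_through_def)
  show "clique_rest (e, S) \<subseteq> all_pairs V" using S by (auto simp: clique_rest_def all_pairs_def)
  have "e \<in> all_pairs S" using assms(2) S by (auto simp: all_pairs_def)
  then show "card (clique_rest (e, S)) = (s choose 2) - 1"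
    using S by (simp add: clique_rest_def card_all_pairs)
qed

lemma wsat_flip:
  assumes V: "finite V" and s: "2 \<le> s" and e: "e \<in> all_pairs V" and \<omega>: "\<omega> \<subseteq> all_pairs V" "e \<notin> \<omega>"
    and av: "avoids clique_rest (rest_index V s {e}) \<omega>"
  shows "wsat (Graph V (insert e \<omega>)) (complete_graph s) = Suc (wsat (Graph V \<omega>) (complete_graph s))"
proof -
  have "wsat (add_edge e (Graph V \<omega>)) (complete_graph s) = Suc (wsat (Graph V \<omega>) (complete_graph s))"
  proof (rule wsat_add_edge)
    fix C assume C: "copy_in C (complete_graph s) (add_edge e (Graph V \<omega>))"
    show "e \<notin> edges C"
    proof
      assume "e \<in> edges C"
      let ?S = "verts C"
      have S: "?S \<subseteq> V" "card ?S = s" "edges C = all_pairs ?S" "edges C \<subseteq> insert e \<omega>"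
        using copy_of_complete_graph[OF C] by (auto simp: add_edge_def)
      then have "(e, ?S) \<in> rest_index V s {e}"
        using \<open>e \<in> edges C\<close> by (auto simp: cliques_through_def all_pairs_def)
      moreover have "clique_rest (e, ?S) \<subseteq> \<omega>" using S by (auto simp: clique_rest_def)
      ultimately show False using av unfolding avoids_def by blast
    qed
  qed (use assms complete_graph_edges_nonempty in \<open>auto simp: simple_graph_def\<close>)
  then show ?thesis by (simp add: add_edge_def)
qed

lemma two_times_choose_two: "2 * int (m choose 2) = int m * (int m - 1)"
proof (cases m)
  case (Suc k)
  have "even (m * (m - 1))" by (cases m) auto
  then have "2 * (m choose 2) = m * (m - 1)" unfolding choose_two by (rule dvd_mult_div_cancel)
  then have "int (2 * (m choose 2)) = int (m * (m - 1))" by (rule arg_cong)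
  then show ?thesis using Suc by (simp add: algebra_simps)
qed simp

text \<open>With \<open>t\<close> common vertices the two sets share at most \<open>t choose 2\<close> pairs, one fewer if \<open>e\<^sub>1 = e\<^sub>2\<close>.
  The inequality then reduces to \<open>(t - 2) (s - t) \<ge> 1\<close> if \<open>e\<^sub>1 = e\<^sub>2\<close>, and to \<open>(t - 1) (s + 1 - t) \<ge> 1\<close> otherwise.\<close>

lemma clique_overlap:
  assumes V: "finite V" and s: "3 \<le> s" and e: "e1 \<in> all_pairs V" "e2 \<in> all_pairs V"
    and S: "S1 \<in> cliques_through V s e1" "S2 \<in> cliques_through V s e2"
    and ne: "(e1, S1) \<noteq> (e2, S2)" and meet: "clique_rest (e1, S1) \<inter> clique_rest (e2, S2) \<noteq> {}"
  shows "1 + (s + 1) * (card (S1 \<union> S2) - card (e1 \<union> e2)) \<le> 2 * card (clique_rest (e1, S1) \<union> clique_rest (e2, S2))"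
proof -
  define T where "T = S1 \<inter> S2"
  define t c u m where "t = card T" and "c = card (clique_rest (e1, S1) \<inter> clique_rest (e2, S2))"
    and "u = card (e1 \<union> e2)" and "m = card (clique_rest (e1, S1) \<union> clique_rest (e2, S2))"
  have SV: "S1 \<subseteq> V" "S2 \<subseteq> V" "card S1 = s" "card S2 = s" "e1 \<subseteq> S1" "e2 \<subseteq> S2"
    using S by (auto simp: cliques_through_def)
  have f: "finite S1" "finite S2" using finite_subset[OF SV(1) V] finite_subset[OF SV(2) V] .
  then have fT: "finite T" by (simp add: T_def)
  have ce: "card e1 = 2" "card e2 = 2" using e by (auto simp: all_pairs_def)
  have fe: "finite e1" "finite e2" using SV f finite_subset by auto
  have fr: "finite (clique_rest (e1, S1))" "finite (clique_rest (e2, S2))"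
    using f finite_all_pairs by (auto simp: clique_rest_def)
  have un: "card (S1 \<union> S2) + t = 2 * s"
    using card_Un_Int[of S1 S2] f SV by (simp add: t_def T_def)
  have "m + c = 2 * ((s choose 2) - 1)"
    using card_Un_Int[OF fr] clique_rest_props(2)[OF V e(1) S(1)] clique_rest_props(2)[OF V e(2) S(2)]
    by (simp add: m_def c_def)
  moreover have "0 < s choose 2" using s by simp
  ultimately have "2 * int m + 2 * int c = 2 * (2 * int (s choose 2)) - 4"
    by linarith
  then have mc: "2 * int m = 2 * (int s * (int s - 1)) - 4 - 2 * int c"
    unfolding two_times_choose_two by simp
  have "t \<le> s" using card_mono[of S1 T] f SV by (simp add: t_def T_def)
  have ule: "u \<le> card (S1 \<union> S2)"
    unfolding u_def using SV f by (intro card_mono) auto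
  have main: "1 + (int s + 1) * (2 * int s - int t - int u) \<le> 2 * int m"
  proof (cases "e1 = e2")
    case True
    then have "S1 \<noteq> S2" using ne by auto
    have "t \<noteq> s"
    proof
      assume "t = s"
      have TS: "T \<subseteq> S1" "T \<subseteq> S2" by (auto simp: T_def)
      have "T = S1" "T = S2"
        using card_subset_eq[OF f(1) TS(1)] card_subset_eq[OF f(2) TS(2)] SV \<open>t = s\<close>
        by (simp_all add: t_def)
      then show False using \<open>S1 \<noteq> S2\<close> by simp
    qed
    have u: "u = 2" using True ce by (simp add: u_def)
    have eT: "e1 \<in> all_pairs T" using True SV ce by (auto simp: all_pairs_def T_def)
    have inter: "clique_rest (e1, S1) \<inter> clique_rest (e2, S2) = all_pairs T - {e1}"
      using True by (auto simp: clique_rest_def all_pairs_def T_def)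
    then have "c = (t choose 2) - 1"
      using eT fT by (simp add: c_def card_all_pairs t_def)
    moreover have "c \<noteq> 0"
      using meet fr by (simp add: c_def)
    ultimately have c: "2 * int c = int t * (int t - 1) - 2"
      unfolding two_times_choose_two[symmetric] by linarith
    have "2 \<le> t" using eT card_mono[OF fT, of e1] by (auto simp: all_pairs_def t_def)
    \<comment> \<open>With two common vertices the only common pair would be \<open>e1\<close>,
      which is removed from both sets.\<close>
    moreover have "t \<noteq> 2" using c \<open>c \<noteq> 0\<close> by auto
    ultimately have "1 * 1 \<le> (int t - 2) * (int s - int t)"
      using \<open>t \<le> s\<close> \<open>t \<noteq> s\<close> by (intro mult_mono) auto
    then show ?thesis unfolding mc c u by (simp add: algebra_simps)
  next
    case False
    have "clique_rest (e1, S1) \<inter> clique_rest (e2, S2) \<subseteq> all_pairs T"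
      by (auto simp: clique_rest_def all_pairs_def T_def)
    then have "c \<le> t choose 2" "all_pairs T \<noteq> {}"
      using card_mono[OF finite_all_pairs[OF fT]] card_all_pairs[OF fT] meet by (auto simp: c_def t_def)
    then have c: "2 * int c \<le> int t * (int t - 1)"
      unfolding two_times_choose_two[symmetric] by linarith
    obtain x where "x \<subseteq> T" "card x = 2" using \<open>all_pairs T \<noteq> {}\<close> by (auto simp: all_pairs_def)
    then have "2 \<le> t" using card_mono[OF fT, of x] by (simp add: t_def)
    have "\<not> e2 \<subseteq> e1" using False ce fe card_subset_eq by metis
    then have "e1 \<subset> e1 \<union> e2" by auto
    then have "card e1 < card (e1 \<union> e2)" using fe by (intro psubset_card_mono) auto
    then have u: "3 \<le> u" using ce by (simp add: u_def)
    have "1 * 1 \<le> (int t - 1) * (int s + 1 - int t)"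
      using \<open>t \<le> s\<close> \<open>2 \<le> t\<close> by (intro mult_mono) auto
    moreover have "(int s + 1) * (2 * int s - int t - int u) \<le> (int s + 1) * (2 * int s - int t - 3)"
      using u by (intro mult_left_mono) auto
    ultimately show ?thesis unfolding mc using c by (simp add: algebra_simps)
  qed
  \<comment> \<open>This subtraction does not truncate, because \<open>e1 \<union> e2\<close> is
    contained in \<open>S1 \<union> S2\<close>.\<close>
  define d where "d = card (S1 \<union> S2) - u"
  have d: "int d = 2 * int s - int t - int u"
    using un ule unfolding d_def by linarith
  have "int (1 + (s + 1) * d) \<le> int (2 * m)"
    using main by (simp only: of_nat_add of_nat_mult of_nat_1 of_nat_numeral d)
  then show ?thesis unfolding u_def m_def d_def by (simp only: of_nat_le_iff)
qed

section \<open>Summing the correlation over overlapping cliques\<close>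

text \<open>Pairs are grouped by their union \<open>W\<close>, which arises from at most
  \<open>4 ^ r\<close> pairs of subsets. For each m up to \<open>r\<close> there are at most |V|^m
  choices of \<open>W - U\<close> of size m, each of weight x^m, so every m contributes at most
  1.\<close>

lemma sum_unions_le:
  assumes V: "finite V" "U \<subseteq> V" and x: "0 \<le> x" "real (card V) * x \<le> 1"
    and P: "\<And>S1 S2. (S1, S2) \<in> P \<Longrightarrow> S1 \<subseteq> V \<and> S2 \<subseteq> V \<and> U \<subseteq> S1 \<union> S2 \<and> card (S1 \<union> S2) \<le> r"
  shows "(\<Sum>(S1, S2)\<in>P. x ^ (card (S1 \<union> S2) - card U)) \<le> 4 ^ r * (real r + 1)"
proof -
  define Ws where "Ws = {W. U \<subseteq> W \<and> W \<subseteq> V \<and> card W \<le> r}"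
  define h where "h W = x ^ (card W - card U)" for W :: "'a set"
  have finW: "finite Ws" unfolding Ws_def by (rule finite_subset[of _ "Pow V"]) (use V in auto)
  have h0: "0 \<le> h W" for W using x by (simp add: h_def)
  have fW: "finite W" if "W \<in> Ws" for W using that V finite_subset by (auto simp: Ws_def)
  let ?D = "Sigma Ws (\<lambda>W. Pow W \<times> Pow W)"
  let ?j = "\<lambda>(S1, S2). (S1 \<union> S2, (S1, S2))"
  have "(\<Sum>(S1, S2)\<in>P. x ^ (card (S1 \<union> S2) - card U)) = (\<Sum>z\<in>?j ` P. h (fst z))"
    by (subst sum.reindex) (auto simp: inj_on_def h_def intro!: sum.cong)
  also have "\<dots> \<le> (\<Sum>z\<in>?D. h (fst z))"
  proof (rule sum_mono2)
    show "finite ?D" using finW fW by (intro finite_SigmaI) auto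
    show "?j ` P \<subseteq> ?D"
    proof
      fix z assume "z \<in> ?j ` P"
      then obtain S1 S2 where "(S1, S2) \<in> P" "z = (S1 \<union> S2, (S1, S2))" by auto
      then show "z \<in> ?D" using P[of S1 S2] by (simp add: Ws_def)
    qed
  qed (rule h0)
  also have "\<dots> = (\<Sum>W\<in>Ws. \<Sum>_\<in>Pow W \<times> Pow W. h W)"
    using finW fW by (subst sum.Sigma) (auto simp: case_prod_beta)
  also have "\<dots> = (\<Sum>W\<in>Ws. 4 ^ card W * h W)"
    using fW by (intro sum.cong) (auto simp: card_cartesian_product card_Pow power_mult_distrib[symmetric])
  also have "\<dots> \<le> (\<Sum>W\<in>Ws. 4 ^ r * h W)"
    using h0 by (intro sum_mono mult_right_mono) (auto simp: Ws_def intro!: power_increasing)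
  also have "\<dots> = 4 ^ r * (\<Sum>W\<in>Ws. h W)" by (simp add: sum_distrib_left)
  also have "(\<Sum>W\<in>Ws. h W) \<le> real r + 1"
  proof -
    let ?Y = "{Y. Y \<subseteq> V \<and> card Y \<le> r}"
    have inj: "inj_on (\<lambda>W. W - U) Ws" by (auto simp: inj_on_def Ws_def)
    have hU: "h W = x ^ card (W - U)" if "W \<in> Ws" for W
      using that V finite_subset[of U V] by (auto simp: h_def Ws_def card_Diff_subset)
    have finY: "finite ?Y" by (rule finite_subset[of _ "Pow V"]) (use V in auto)
    have "(\<Sum>W\<in>Ws. h W) = (\<Sum>Y\<in>(\<lambda>W. W - U) ` Ws. x ^ card Y)"
      using inj by (simp add: sum.reindex hU)
    also have "\<dots> \<le> (\<Sum>Y\<in>?Y. x ^ card Y)"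
    proof (intro sum_mono2 finY)
      show "(\<lambda>W. W - U) ` Ws \<subseteq> ?Y"
        using fW by (auto simp: Ws_def intro: order_trans[OF card_mono])
    qed (use x in auto)
    also have "\<dots> = (\<Sum>m\<le>r. \<Sum>Y | Y \<in> ?Y \<and> card Y = m. x ^ card Y)"
      by (rule sum.group[symmetric]) (use finY in auto)
    also have "\<dots> \<le> (\<Sum>m\<le>r. 1)"
    proof (intro sum_mono)
      fix m assume "m \<in> {..r}"
      then have eq: "{Y. Y \<in> ?Y \<and> card Y = m} = {Y. Y \<subseteq> V \<and> card Y = m}" by auto
      have "(\<Sum>Y | Y \<in> ?Y \<and> card Y = m. x ^ card Y) = real (card V choose m) * x ^ m"
        unfolding eq using n_subsets[OF V(1), of m] by simp
      also have "\<dots> \<le> real (card V) ^ m * x ^ m"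
      proof -
        have "(card V choose m) \<le> card V ^ m"
          by (cases "m \<le> card V") (auto intro: binomial_le_pow simp: binomial_eq_0)
        then show ?thesis using x by (intro mult_right_mono) (auto simp flip: of_nat_power)
      qed
      also have "\<dots> = (real (card V) * x) ^ m" by (simp add: power_mult_distrib)
      also have "\<dots> \<le> 1" using x by (intro power_le_one) auto
      finally show "(\<Sum>Y | Y \<in> ?Y \<and> card Y = m. x ^ card Y) \<le> 1" .
    qed
    finally show ?thesis by simp
  qed
  finally show ?thesis by simp
qed

text \<open>The sum in the exponent of Janson's bound for the sets
  \<open>clique_rest i\<close>.\<close>

definition overlap :: "'a set \<Rightarrow> nat \<Rightarrow> real \<Rightarrow> 'a set set \<Rightarrow> real" where
  "overlap V s p Q = (\<Sum>(i, j) | i \<in> rest_index V s Q \<and> j \<in> rest_index V s Q \<and> i \<noteq> j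
      \<and> clique_rest j \<inter> clique_rest i \<noteq> {}. p ^ card (clique_rest i \<union> clique_rest j))"

text \<open>If the union of the two cliques has d vertices outside \<open>e1 \<union> e2\<close>,
  \<open>clique_overlap\<close> bounds a term by |V|^(-d) times \<Lambda>^(2k) / g, where k = (s
  choose 2) - 1. The power of |V| pays for placing these d vertices, and the factor 1 / g is the
  gain. The grouping by unions of size at most 2 s costs \<open>4 ^ (2 * s)\<close>, and at most
  four choices of (e1, e2) from \<open>Q\<close> cost another 4.\<close>

lemma overlap_le:
  assumes V: "finite V" and s: "3 \<le> s" and Q: "Q \<subseteq> all_pairs V" "card Q \<le> 2" "finite Q"
    and g: "1 \<le> g" "g ^ (s + 1) = real (card V)" and p: "0 \<le> p" "p \<le> \<Lambda> / g\<^sup>2" "1 \<le> \<Lambda>"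
  shows "overlap V s p Q \<le> 4 ^ (2 * s + 1) * (2 * real s + 1) * \<Lambda> ^ (2 * ((s choose 2) - 1)) / g"
proof -
  let ?r = clique_rest and ?I = "rest_index V s Q" and ?k = "(s choose 2) - 1"
  define L where "L = \<Lambda> ^ (2 * ?k) / g"
  have L0: "0 \<le> L" using g p by (simp add: L_def)
  let ?h = "\<lambda>(i, j). (1 / real (card V)) ^ (card (snd i \<union> snd j) - card (fst i \<union> fst j))"
  have finI: "finite ?I" using Q V finite_cliques_through by blast
  have sig: "(\<Sum>i\<in>?I. F i) = (\<Sum>e\<in>Q. \<Sum>S\<in>cliques_through V s e. F (e, S))" for F :: "_ \<Rightarrow> real"
    using Q V by (subst sum.Sigma) (auto simp: finite_cliques_through case_prod_beta)
  have bound: "p ^ card (?r i \<union> ?r j) \<le> L * ?h (i, j)"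
    if ij: "i \<in> ?I" "j \<in> ?I" "i \<noteq> j" "?r j \<inter> ?r i \<noteq> {}" for i j
  proof -
    obtain e1 S1 e2 S2 where i: "i = (e1, S1)" and j: "j = (e2, S2)" by (cases i; cases j)
    define m d where "m = card (?r i \<union> ?r j)" and "d = card (S1 \<union> S2) - card (e1 \<union> e2)"
    have e: "e1 \<in> all_pairs V" "e2 \<in> all_pairs V" and S: "S1 \<in> cliques_through V s e1" "S2 \<in> cliques_through V s e2"
      using ij Q by (auto simp: i j)
    have md: "1 + (s + 1) * d \<le> 2 * m"
      unfolding d_def m_def i j using ij by (intro clique_overlap[OF V s e S]) (auto simp: i j)
    have "m \<le> card (?r i) + card (?r j)" unfolding m_def by (rule card_Un_le)
    then have mk: "m \<le> 2 * ?k"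
      using clique_rest_props(2)[OF V e(1) S(1)] clique_rest_props(2)[OF V e(2) S(2)] by (simp add: i j)
    have "p ^ m \<le> (\<Lambda> / g\<^sup>2) ^ m" using p by (intro power_mono) auto
    also have "\<dots> = \<Lambda> ^ m / g ^ (2 * m)" by (simp add: power_divide power_mult)
    also have "\<dots> \<le> \<Lambda> ^ (2 * ?k) / g ^ (1 + (s + 1) * d)"
      using g p md mk by (intro frac_le power_increasing) auto
    also have "\<dots> = L * (1 / real (card V)) ^ d"
      unfolding g(2)[symmetric] by (simp add: L_def power_add power_mult power_divide power_mult_distrib)
    finally show ?thesis by (simp add: m_def d_def i j)
  qed
  have inner: "(\<Sum>(S1, S2)\<in>cliques_through V s e1 \<times> cliques_through V s e2.
      (1 / real (card V)) ^ (card (S1 \<union> S2) - card (e1 \<union> e2))) \<le> 4 ^ (2 * s) * (real (2 * s) + 1)"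
    if "e1 \<in> Q" "e2 \<in> Q" for e1 e2
  proof (rule sum_unions_le[OF V])
    show "e1 \<union> e2 \<subseteq> V" using that Q by (auto simp: all_pairs_def)
    fix S1 S2 assume "(S1, S2) \<in> cliques_through V s e1 \<times> cliques_through V s e2"
    then show "S1 \<subseteq> V \<and> S2 \<subseteq> V \<and> e1 \<union> e2 \<subseteq> S1 \<union> S2 \<and> card (S1 \<union> S2) \<le> 2 * s"
      using card_Un_le[of S1 S2] by (auto simp: cliques_through_def)
  qed auto
  have "overlap V s p Q \<le> (\<Sum>z | fst z \<in> ?I \<and> snd z \<in> ?I \<and> fst z \<noteq> snd z
      \<and> ?r (snd z) \<inter> ?r (fst z) \<noteq> {}. L * ?h z)"
    unfolding overlap_def case_prod_beta using bound by (intro sum_mono) (auto simp: case_prod_beta)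
  also have "\<dots> \<le> (\<Sum>z\<in>?I \<times> ?I. L * ?h z)"
    using finI L0 by (intro sum_mono2) (auto simp: mem_Times_iff)
  also have "\<dots> = L * (\<Sum>z\<in>?I \<times> ?I. ?h z)" by (simp add: sum_distrib_left)
  also have "(\<Sum>z\<in>?I \<times> ?I. ?h z) = (\<Sum>i\<in>?I. \<Sum>j\<in>?I. ?h (i, j))"
    by (simp add: sum.cartesian_product)
  also have "\<dots> = (\<Sum>e1\<in>Q. \<Sum>S1\<in>cliques_through V s e1. \<Sum>e2\<in>Q. \<Sum>S2\<in>cliques_through V s e2. ?h ((e1, S1), (e2, S2)))"
    by (simp only: sig)
  also have "\<dots> = (\<Sum>e1\<in>Q. \<Sum>e2\<in>Q. \<Sum>S1\<in>cliques_through V s e1. \<Sum>S2\<in>cliques_through V s e2. ?h ((e1, S1), (e2, S2)))"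
    by (intro sum.cong refl sum.swap)
  also have "\<dots> \<le> (\<Sum>e1\<in>Q. \<Sum>e2\<in>Q. 4 ^ (2 * s) * (real (2 * s) + 1))"
    using inner by (intro sum_mono) (simp add: sum.cartesian_product)
  also have "\<dots> = real (card Q * card Q) * (4 ^ (2 * s) * (real (2 * s) + 1))" by simp
  also have "\<dots> \<le> 4 * (4 ^ (2 * s) * (real (2 * s) + 1))"
  proof (intro mult_right_mono)
    have "card Q * card Q \<le> 2 * 2" using Q by (intro mult_le_mono) auto
    then show "real (card Q * card Q) \<le> 4" by linarith
  qed auto
  finally have "overlap V s p Q \<le> L * (4 * (4 ^ (2 * s) * (real (2 * s) + 1)))"
    using L0 by (simp add: mult_left_mono)
  then show ?thesis by (simp add: L_def algebra_simps add_divide_distrib)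
qed

section \<open>The random graph\<close>

lemma prob_erdos_renyi:
  assumes "0 \<le> p" "p \<le> 1"
  shows "measure_pmf.prob (erdos_renyi n p) {G. P G}
    = expect p (all_pairs {1..n}) (\<lambda>\<omega>. of_bool (P (Graph {1..n} \<omega>)))"
proof -
  let ?E = "all_pairs {1..n}"
  let ?M = "Pi_pmf ?E False (\<lambda>_. bernoulli_pmf p)"
  let ?S = "{b. P (Graph {1..n} {e \<in> ?E. b e})}"
  let ?D = "(\<lambda>\<omega> x. x \<in> \<omega>) ` Pow ?E"
  have fin: "finite ?E" by (simp add: finite_all_pairs)
  have "measure_pmf.prob (erdos_renyi n p) {G. P G} = measure_pmf.prob ?M ?S"
    by (simp add: erdos_renyi_def vimage_def)
  \<comment> \<open>Only indicators of subsets of \<open>?E\<close> carry mass: any other function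
    is true somewhere outside \<open>?E\<close>, where the product has the default value
    \<open>False\<close>. This leaves a finite sum.\<close>
  also have "\<dots> = measure_pmf.prob ?M (?S \<inter> ?D)"
  proof (rule measure_prob_cong_0)
    fix b assume "b \<in> ?S - ?S \<inter> ?D"
    then have "b \<notin> ?D" by auto
    then have "\<exists>x. x \<notin> ?E \<and> b x"
    proof (rule contrapos_np)
      assume "\<not> (\<exists>x. x \<notin> ?E \<and> b x)"
      then have "{x. b x} \<in> Pow ?E" by auto
      then show "b \<in> ?D" by (intro image_eqI[of _ _ "{x. b x}"]) auto
    qed
    then show "pmf ?M b = 0" using fin by (auto simp: pmf_Pi)
  qed auto
  also have "\<dots> = (\<Sum>b\<in>?S \<inter> ?D. pmf ?M b)"
    using fin by (intro measure_measure_pmf_finite) auto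
  also have "\<dots> = (\<Sum>b\<in>?D. of_bool (b \<in> ?S) * pmf ?M b)"
    using fin by (intro sum.mono_neutral_cong_left) auto
  also have "\<dots> = (\<Sum>\<omega>\<in>Pow ?E. of_bool ((\<lambda>x. x \<in> \<omega>) \<in> ?S) * pmf ?M (\<lambda>x. x \<in> \<omega>))"
    by (subst sum.reindex) (auto simp: inj_on_def fun_eq_iff)
  also have "\<dots> = expect p ?E (\<lambda>\<omega>. of_bool (P (Graph {1..n} \<omega>)))"
    unfolding expect_def
  proof (intro sum.cong refl)
    fix \<omega> assume \<omega>: "\<omega> \<in> Pow ?E"
    then have "{e \<in> ?E. e \<in> \<omega>} = \<omega>" by auto
    moreover have "pmf ?M (\<lambda>x. x \<in> \<omega>) = (\<Prod>e\<in>?E. if e \<in> \<omega> then p else 1 - p)"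
      using \<omega> fin assms by (subst pmf_Pi) (auto intro!: prod.cong)
    ultimately show "of_bool ((\<lambda>x. x \<in> \<omega>) \<in> ?S) * pmf ?M (\<lambda>x. x \<in> \<omega>)
        = (\<Prod>e\<in>?E. if e \<in> \<omega> then p else 1 - p) * of_bool (P (Graph {1..n} \<omega>))"
      by simp
  qed
  finally show ?thesis .
qed

lemma expect_card:
  assumes "finite E"
  shows "expect p E (\<lambda>\<omega>. real (card \<omega>)) = real (card E) * p"
proof -
  have "expect p E (\<lambda>\<omega>. real (card \<omega>)) = expect p E (\<lambda>\<omega>. \<Sum>e\<in>E. of_bool ({e} \<subseteq> \<omega>))"
  proof (rule expect_cong)
    fix \<omega> assume "\<omega> \<subseteq> E"
    then have "E \<inter> {x. x \<in> \<omega>} = \<omega>" by auto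
    then show "real (card \<omega>) = (\<Sum>e\<in>E. of_bool ({e} \<subseteq> \<omega>))" using assms by simp
  qed
  also have "\<dots> = (\<Sum>e\<in>E. p ^ card {e})"
    unfolding expect_sum by (intro sum.cong refl expect_superset assms) auto
  finally show ?thesis by simp
qed

section \<open>Probability that adding given pairs creates no clique\<close>

lemma prod_clique_rest:
  assumes "finite V" "2 \<le> s" "Q \<subseteq> all_pairs V"
  shows "(\<Prod>j\<in>rest_index V s Q. 1 - p ^ card (clique_rest j))
    = ((1 - p ^ ((s choose 2) - 1)) ^ ((card V - 2) choose (s - 2))) ^ card Q"
proof -
  have "finite Q" using assms finite_all_pairs finite_subset by blast
  then have "card (rest_index V s Q) = ((card V - 2) choose (s - 2)) * card Q"
    using assms by (subst card_SigmaI) (auto simp: finite_cliques_through card_cliques_through subset_iff)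
  moreover have "(\<Prod>j\<in>rest_index V s Q. 1 - p ^ card (clique_rest j))
      = (\<Prod>j\<in>rest_index V s Q. 1 - p ^ ((s choose 2) - 1))"
    using assms(3) by (intro prod.cong) (auto simp: clique_rest_props(2)[OF assms(1)] subset_iff)
  ultimately show ?thesis by (simp add: power_mult)
qed

lemma avoids_clique_rest_upper:
  assumes "finite V" "2 \<le> s" "Q \<subseteq> all_pairs V" "0 \<le> p" "p \<le> 1" "p ^ ((s choose 2) - 1) \<le> 1 / 2"
    and "overlap V s p Q \<le> \<Delta>"
  shows "expect p (all_pairs V) (\<lambda>\<omega>. of_bool (avoids clique_rest (rest_index V s Q) \<omega>))
    \<le> ((1 - p ^ ((s choose 2) - 1)) ^ ((card V - 2) choose (s - 2))) ^ card Q * exp (2 * \<Delta>)"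
proof -
  have Q: "finite Q" using assms finite_all_pairs finite_subset by blast
  have "expect p (all_pairs V) (\<lambda>\<omega>. of_bool (avoids clique_rest (rest_index V s Q) \<omega>))
      \<le> (\<Prod>j\<in>rest_index V s Q. 1 - p ^ card (clique_rest j)) * exp (2 * overlap V s p Q)"
    unfolding overlap_def
  proof (rule janson)
    show "finite (rest_index V s Q)" using Q assms(1) finite_cliques_through by blast
    fix j assume "j \<in> rest_index V s Q"
    then obtain e S where j: "j = (e, S)" "e \<in> all_pairs V" "S \<in> cliques_through V s e"
      using assms(3) by auto
    show "clique_rest j \<subseteq> all_pairs V" "p ^ card (clique_rest j) \<le> 1 / 2"
      using clique_rest_props[OF assms(1) j(2,3)] assms(6) by (simp_all add: j(1))
  qed (use assms finite_all_pairs in auto)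
  also have "\<dots> \<le> (\<Prod>j\<in>rest_index V s Q. 1 - p ^ card (clique_rest j)) * exp (2 * \<Delta>)"
    using assms by (intro mult_left_mono prod_nonneg) (auto simp: power_le_one)
  finally show ?thesis by (simp only: prod_clique_rest[OF assms(1-3)])
qed

lemma avoids_clique_rest_lower:
  assumes "finite V" "2 \<le> s" "e \<in> all_pairs V" "0 \<le> p" "p \<le> 1"
  shows "(1 - p ^ ((s choose 2) - 1)) ^ ((card V - 2) choose (s - 2))
    \<le> expect p (all_pairs V) (\<lambda>\<omega>. of_bool (avoids clique_rest (rest_index V s {e}) \<omega>))"
proof -
  have "(\<Prod>j\<in>rest_index V s {e}. 1 - p ^ card (clique_rest j))
      \<le> expect p (all_pairs V) (\<lambda>\<omega>. of_bool (avoids clique_rest (rest_index V s {e}) \<omega>))"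
    using assms clique_rest_props(1)[OF assms(1)]
    by (intro avoids_ge_prod) (auto simp: finite_all_pairs finite_cliques_through)
  then show ?thesis using prod_clique_rest[of V s "{e}" p] assms by simp
qed

lemma avoids_clique_rest_Diff:
  "avoids clique_rest (rest_index V s {e}) (\<omega> - {e}) = avoids clique_rest (rest_index V s {e}) \<omega>"
  by (auto simp: avoids_def clique_rest_def)

lemma avoids_clique_rest_pair:
  "avoids clique_rest (rest_index V s {e}) \<omega> \<and> avoids clique_rest (rest_index V s {e'}) \<omega>
    \<longleftrightarrow> avoids clique_rest (rest_index V s {e, e'}) \<omega>"
  by (auto simp: avoids_def)

text \<open>The flip statistic is instantiated with \<rho> equal to the probability that would hold
  if the cliques through a pair were independent. Harris' inequality gives the lower bound \<rho>,
  Janson's the upper bounds with \<eta> = exp(2 \<Delta>), and \<open>M0\<close> is any positive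
  lower bound for the count \<open>M\<close>.\<close>

lemma wsat_anticoncentration:
  fixes V :: "'a set"
  assumes V: "finite V" "2 \<le> card V" and s: "3 \<le> s" and p: "0 < p" "p < 1" "p ^ ((s choose 2) - 1) \<le> 1 / 2"
    and g: "1 \<le> g" "g ^ (s + 1) = real (card V)" and \<Lambda>: "1 \<le> \<Lambda>" "p \<le> \<Lambda> / g\<^sup>2"
    and M0: "0 < M0"
      "M0 \<le> real (card V choose 2) * p * (1 - p ^ ((s choose 2) - 1)) ^ ((card V - 2) choose (s - 2))"
    and \<Delta>: "4 ^ (2 * s + 1) * (2 * real s + 1) * \<Lambda> ^ (2 * ((s choose 2) - 1)) / g \<le> \<Delta>"
    and J: "0 < J"
  shows "expect p (all_pairs V) (\<lambda>\<omega>. of_bool (wsat (Graph V \<omega>) (complete_graph s) = k))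
    \<le> 1 / real J + real J * (2 * sqrt (exp (2 * \<Delta>) / M0 + (exp (2 * \<Delta>) - 1 + 2 * p)))"
proof -
  define \<rho> where "\<rho> = (1 - p ^ ((s choose 2) - 1)) ^ ((card V - 2) choose (s - 2))"
  define B where "B e = avoids clique_rest (rest_index V s {e})" for e :: "'a set"
  define T where "T \<omega> = wsat (Graph V \<omega>) (complete_graph s)" for \<omega> :: "'a set set"
  have \<rho>: "0 < \<rho>" unfolding \<rho>_def using p by (intro zero_less_power) auto
  have ov: "overlap V s p Q \<le> \<Delta>" if "Q \<subseteq> all_pairs V" "card Q \<le> 2" "finite Q" for Q
    using overlap_le[OF V(1) s that g _ \<Lambda>(2,1)] p \<Delta> by linarith
  have "0 \<le> \<Delta>" using ov[of "{}"] by (simp add: overlap_def)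
  interpret flip_statistic "all_pairs V" p \<rho> "exp (2 * \<Delta>)" B T
  proof
    show "finite (all_pairs V)" by (rule finite_all_pairs[OF V(1)])
    show "all_pairs V \<noteq> {}"
      using V card_all_pairs[OF V(1)] by (metis card.empty zero_less_binomial_iff less_irrefl)
    show "0 < p" "p < 1" "0 < \<rho>" by fact+
    show "1 \<le> exp (2 * \<Delta>)" using \<open>0 \<le> \<Delta>\<close> by simp
    show "B e \<omega>" if "\<omega> \<subseteq> \<omega>'" "B e \<omega>'" for e \<omega> \<omega>'
      using that unfolding B_def by (rule avoids_antimono)
    show "B e (\<omega> - {e}) = B e \<omega>" for e \<omega>
      unfolding B_def by (rule avoids_clique_rest_Diff)
    show "\<rho> \<le> expect p (all_pairs V) (\<lambda>\<omega>. of_bool (B e \<omega>))" if "e \<in> all_pairs V" for e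
      unfolding B_def \<rho>_def using V s p that by (intro avoids_clique_rest_lower) auto
    show "expect p (all_pairs V) (\<lambda>\<omega>. of_bool (B e \<omega>)) \<le> \<rho> * exp (2 * \<Delta>)" if "e \<in> all_pairs V" for e
      using avoids_clique_rest_upper[of V s "{e}" p \<Delta>] V s p that ov[of "{e}"]
      by (simp add: B_def \<rho>_def)
    show "expect p (all_pairs V) (\<lambda>\<omega>. of_bool (B e \<omega> \<and> B e' \<omega>)) \<le> \<rho>\<^sup>2 * exp (2 * \<Delta>)"
      if "e \<in> all_pairs V" "e' \<in> all_pairs V" "e \<noteq> e'" for e e'
      using avoids_clique_rest_upper[of V s "{e, e'}" p \<Delta>] V s p that ov[of "{e, e'}"]
      by (simp add: B_def \<rho>_def avoids_clique_rest_pair power2_eq_square)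
    show "T (insert e \<omega>) = Suc (T \<omega>)"
      if "e \<in> all_pairs V" "\<omega> \<subseteq> all_pairs V" "e \<notin> \<omega>" "B e \<omega>" for e \<omega>
      using that V s unfolding T_def B_def by (intro wsat_flip) auto
  qed
  define D where "D = 2 * sqrt (exp (2 * \<Delta>) / M0 + (exp (2 * \<Delta>) - 1 + 2 * p))"
  have "exp (2 * \<Delta>) / (real (card (all_pairs V)) * p * \<rho>) \<le> exp (2 * \<Delta>) / M0"
    using M0 unfolding card_all_pairs[OF V(1)] \<rho>_def by (intro divide_left_mono) auto
  then have "\<delta> \<le> D" by (simp add: \<delta>_def D_def)
  have "real J * f k \<le> 1 + (real J)\<^sup>2 * \<delta>" by (rule anticoncentration)
  also have "\<dots> \<le> 1 + (real J)\<^sup>2 * D" using \<open>\<delta> \<le> D\<close> by (simp add: mult_left_mono)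
  also have "\<dots> = real J * (1 / real J + real J * D)" using J by (simp add: power2_eq_square algebra_simps)
  finally have "f k \<le> 1 / real J + real J * D" using J by (simp only: mult_le_cancel_left_pos of_nat_0_less_iff)
  then show ?thesis by (simp only: f_def T_def D_def)
qed

section \<open>Asymptotics at the threshold\<close>

lemma ln_powr_over_powr_tendsto_0:
  assumes "(0::real) < A" "0 < a" "0 < b"
  shows "(\<lambda>n::nat. (A * ln n) powr b / n powr a) \<longlonglongrightarrow> 0"
  using assms by real_asymp

lemma ln_squared_over_powr_tendsto_0:
  assumes "(0::real) < A" "0 < a"
  shows "(\<lambda>n::nat. K * (A * ln n)\<^sup>2 / n powr a) \<longlonglongrightarrow> 0"
  using assms by real_asymp

lemma ln_powr_at_top:
  assumes "(0::real) < A" "0 < b"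
  shows "filterlim (\<lambda>n::nat. (A * ln n) powr b / (4 * exp 1)) at_top at_top"
  using assms by real_asymp

lemma ln_squared_eventually_le:
  assumes "(0::real) < A" "0 < \<beta>"
  shows "\<forall>\<^sub>F n::nat in sequentially. 2 * (\<beta> * ln n) * (A * ln n) \<le> n"
  using assms by real_asymp

lemma ln_eventually_ge:
  assumes "(0::real) < A"
  shows "\<forall>\<^sub>F n::nat in sequentially. K \<le> A * ln n"
  using assms by real_asymp

text \<open>Explains the exponents at the threshold: with k = (s choose 2) - 1, the k-th power of
  n^(2/(s+1)) is n^(s-2), and the exponent of the logarithm in \<open>q_fun\<close> is 1/k.\<close>

lemma clique_exponent:
  assumes "2 \<le> s"
  shows "2 * ((s choose 2) - 1) = (s - 2) * (s + 1)"
proof -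
  obtain r where r: "s = r + 2" using assms by (metis le_add_diff_inverse2)
  define c where "c = s choose 2"
  have "2 * int c = int s * (int s - 1)" unfolding c_def by (rule two_times_choose_two)
  moreover have "0 < c" using assms by (simp add: c_def)
  then have "int (2 * (c - 1)) = 2 * int c - 2" by (simp add: of_nat_diff)
  ultimately have "int (2 * (c - 1)) = int ((s - 2) * (s + 1))"
    by (simp add: r algebra_simps)
  then show ?thesis by (simp only: of_nat_eq_iff c_def)
qed

text \<open>Concavity of \<open>ln y + L * (1 - y)\<close> is the reason: it vanishes at \<open>y = 1\<close> and is nonnegative at \<open>y = exp (- L / 2)\<close>.\<close>

lemma unimodal_lower:
  fixes y L :: real
  assumes "0 < y" "y \<le> 1" "2 \<le> L" "- L / 2 \<le> ln y"
  shows "1 \<le> y * exp (L * (1 - y))"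
proof -
  have "0 \<le> ln y + L * (1 - y)"
  proof (cases "y \<le> 1 / 2")
    case True
    then have "L * (1 / 2) \<le> L * (1 - y)" using assms by (intro mult_left_mono) auto
    then show ?thesis using assms by linarith
  next
    case False
    have "ln (1 / y) \<le> 1 / y - 1" using assms by (intro ln_le_minus_one) auto
    also have "\<dots> = (1 - y) * (1 / y)" using assms by (simp add: field_simps)
    also have "\<dots> \<le> (1 - y) * L"
      using assms False by (intro mult_left_mono order_trans[OF _ assms(3)]) (auto simp: field_simps)
    finally show ?thesis using assms by (simp add: ln_div mult.commute)
  qed
  then have "exp 0 \<le> exp (ln y + L * (1 - y))" by (simp only: exp_le_cancel_iff)
  then show ?thesis using assms by (simp add: exp_add)
qed

text \<open>With p equal to y times the threshold and L = \<beta> ln n, the count is, up to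
  constants, at least \<Lambda> y exp(L (1 - y)), which \<open>unimodal_lower\<close> bounds below
  on the whole range of \<open>y\<close>. In the constant, 4 comes from \<open>n choose 2\<close>
  being at least n^2 / 4, and \<open>exp 1\<close> from the quadratic error in ln(1 - x).\<close>

lemma expected_count_lower:
  fixes A \<beta> \<Lambda> g p y :: real and n s :: nat
  defines "k \<equiv> (s choose 2) - 1"
  assumes s: "3 \<le> s" and n: "2 \<le> n"
    and A: "A = \<beta> * fact (s - 2)" and \<beta>: "0 < \<beta>" "2 \<le> \<beta> * ln n" "2 * (\<beta> * ln n) * (A * ln n) \<le> n"
    and \<Lambda>: "0 < \<Lambda>" "\<Lambda> ^ k = A * ln n" and g: "0 < g" "g ^ (s + 1) = n" "(real n)\<^sup>2 / g\<^sup>2 = n powr \<beta>"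
    and y: "0 < y" "y \<le> 1" "n powr (- \<beta> / 2) \<le> y" and p: "p = y * (\<Lambda> / g\<^sup>2)" "0 \<le> p" "p ^ k \<le> 1 / 2"
  shows "\<Lambda> / (4 * exp 1) \<le> real (n choose 2) * p * (1 - p ^ k) ^ ((n - 2) choose (s - 2))"
proof -
  define L x C where "L = \<beta> * ln n" and "x = p ^ k" and "C = real ((n - 2) choose (s - 2))"
  have ln: "0 < ln n" using n by simp
  have "L \<ge> 2" using \<beta> by (simp add: L_def)
  have k: "2 * k = (s - 2) * (s + 1)" unfolding k_def using s by (intro clique_exponent) auto
  have "0 < k" using k s by (cases "k = 0") auto
  have "(g\<^sup>2) ^ k = g ^ (2 * k)" by (simp only: power_mult)
  also have "\<dots> = g ^ ((s + 1) * (s - 2))" unfolding k by (simp only: mult.commute)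
  also have "\<dots> = real n ^ (s - 2)" by (simp only: power_mult g(2))
  finally have x: "x = y ^ k * (A * ln n) / real n ^ (s - 2)"
    by (simp only: x_def p(1) power_mult_distrib power_divide \<Lambda>(2) times_divide_eq_right)
  have x0: "0 \<le> x" "x \<le> 1 / 2" using p by (simp_all add: x_def)
  have yk: "y ^ k \<le> y" using power_decreasing[of 1 k y] y \<open>0 < k\<close> by simp
  have A0: "0 < A" using A \<beta> by simp
  have "C * fact (s - 2) = real (((n - 2) choose (s - 2)) * fact (s - 2))" by (simp add: C_def)
  also have "\<dots> \<le> real ((n - 2) ^ (s - 2))" by (simp only: of_nat_le_iff binomial_fact_pow)
  also have "\<dots> \<le> real n ^ (s - 2)" by (simp add: power_mono)
  finally have C: "C * fact (s - 2) \<le> real n ^ (s - 2)" .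
  have "C * x = (C * fact (s - 2)) * (y ^ k * L / real n ^ (s - 2))"
    by (simp add: x A L_def)
  also have "\<dots> \<le> real n ^ (s - 2) * (y ^ k * L / real n ^ (s - 2))"
    using C y \<open>L \<ge> 2\<close> by (intro mult_right_mono) auto
  also have "\<dots> = y ^ k * L" using n by simp
  also have "\<dots> \<le> y * L" using yk \<open>L \<ge> 2\<close> by (intro mult_right_mono) auto
  finally have Cx: "C * x \<le> y * L" .
  have "x \<le> 1 * (A * ln n) / real n ^ (s - 2)"
    unfolding x using y A0 ln by (intro divide_right_mono mult_right_mono) (auto simp: power_le_one)
  also have "\<dots> \<le> (A * ln n) / real n ^ 1"
  proof -
    have "real n ^ 1 \<le> real n ^ (s - 2)" using s n by (intro power_increasing) auto
    then show ?thesis using n A0 ln by (simp only: mult_1) (intro divide_left_mono, auto)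
  qed
  finally have xn: "x \<le> A * ln n / n" by simp
  have "(C * x) * x \<le> L * (A * ln n / n)"
  proof (rule mult_mono)
    have "y * L \<le> 1 * L" using y \<open>L \<ge> 2\<close> by (intro mult_right_mono) auto
    then show "C * x \<le> L" using Cx by simp
  qed (use xn x0 \<open>L \<ge> 2\<close> in auto)
  also have "\<dots> \<le> 1 / 2" using \<beta>(3) n by (simp add: L_def field_simps)
  finally have Cxx: "C * (2 * x\<^sup>2) \<le> 1" by (simp add: power2_eq_square)
  \<comment> \<open>Uses ln(1 - x) >= - x - 2 x^2 for x at most 1/2; \<open>C\<close> times the
    quadratic term is at most 1.\<close>
  have "- (y * L) - 1 \<le> C * (- x - 2 * x\<^sup>2)" using Cx Cxx by (simp add: algebra_simps)
  also have "\<dots> \<le> C * ln (1 - x)"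
    using x0 by (intro mult_left_mono ln_one_minus_pos_lower_bound) (auto simp: C_def)
  finally have "exp (- (y * L) - 1) \<le> exp (C * ln (1 - x))" by simp
  also have "\<dots> = (1 - x) ^ ((n - 2) choose (s - 2))"
    using x0 by (simp add: C_def exp_of_nat_mult)
  finally have \<rho>: "exp (- (y * L) - 1) \<le> (1 - x) ^ ((n - 2) choose (s - 2))" .
  have ch: "(real n)\<^sup>2 / 4 \<le> real (n choose 2)"
  proof -
    have "2 * real (n choose 2) = real_of_int (2 * int (n choose 2))" by simp
    also have "\<dots> = real n * (real n - 1)" unfolding two_times_choose_two by simp
    finally have "2 * real (n choose 2) = real n * (real n - 1)" .
    moreover have "real n * (real n / 2) \<le> real n * (real n - 1)" using n by (intro mult_left_mono) auto
    ultimately show ?thesis by (simp add: power2_eq_square)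
  qed
  have "- L / 2 \<le> ln y"
  proof -
    have "ln (n powr (- \<beta> / 2)) \<le> ln y" using y n by (subst ln_le_cancel_iff) auto
    then show ?thesis using n by (simp add: ln_powr L_def)
  qed
  then have "1 \<le> y * exp (L * (1 - y))" using y \<open>L \<ge> 2\<close> by (intro unimodal_lower) auto
  then have "\<Lambda> / (4 * exp 1) * 1 \<le> \<Lambda> / (4 * exp 1) * (y * exp (L * (1 - y)))"
    using \<Lambda> by (intro mult_left_mono) auto
  also have "\<dots> = (exp L / 4) * (y * \<Lambda>) * exp (- (y * L) - 1)"
    by (simp add: exp_diff exp_minus right_diff_distrib field_simps)
  also have "exp L = (real n)\<^sup>2 / g\<^sup>2" using n by (simp add: g(3) L_def powr_def)
  also have "(real n)\<^sup>2 / g\<^sup>2 / 4 * (y * \<Lambda>) * exp (- (y * L) - 1) = (real n)\<^sup>2 / 4 * p * exp (- (y * L) - 1)"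
    by (simp add: p(1))
  also have "\<dots> \<le> real (n choose 2) * p * (1 - x) ^ ((n - 2) choose (s - 2))"
    using ch p(2) \<rho> by (intro mult_mono mult_right_mono) auto
  finally show ?thesis by (simp add: x_def)
qed

text \<open>Markov's inequality: the weak saturation number is at most the number of edges, so
  reaching \<open>W\<close> requires at least \<open>c\<close> edges.\<close>

lemma prob_wsat_le:
  fixes V :: "'a set" and W :: int
  assumes V: "finite V" and s: "2 \<le> s" and p: "0 \<le> p" "p \<le> 1" and W: "0 < c" "c \<le> real_of_int W"
  shows "expect p (all_pairs V) (\<lambda>\<omega>. of_bool (int (wsat (Graph V \<omega>) (complete_graph s)) = W))
    \<le> real (card V choose 2) * p / c"
proof -
  have "expect p (all_pairs V) (\<lambda>\<omega>. of_bool (int (wsat (Graph V \<omega>) (complete_graph s)) = W))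
      \<le> expect p (all_pairs V) (\<lambda>\<omega>. (1 / c) * real (card \<omega>))"
  proof (intro expect_mono p)
    fix \<omega> assume "\<omega> \<subseteq> all_pairs V"
    then have "wsat (Graph V \<omega>) (complete_graph s) \<le> card \<omega>"
      using wsat_le_card_edges[of "Graph V \<omega>" "complete_graph s"] V complete_graph_edges_nonempty[OF s]
      by (simp add: simple_graph_def)
    then show "of_bool (int (wsat (Graph V \<omega>) (complete_graph s)) = W) \<le> (1 / c) * real (card \<omega>)"
      using W by (auto simp: field_simps)
  qed
  also have "\<dots> = (1 / c) * (real (card V choose 2) * p)"
    by (simp only: expect_cmult expect_card[OF finite_all_pairs[OF V]] card_all_pairs[OF V])
  finally show ?thesis by simp
qed

theorem theorem3p1:
  fixes s :: nat and p :: "nat \<Rightarrow> real"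
  assumes "s \<ge> 3"
    and "\<And>n. 0 \<le> p n \<and> p n \<le> 1"
    and "\<forall>\<^sub>F n in sequentially. p n \<le> c_const s * q_fun s n"
  shows "(\<lambda>n. measure_pmf.prob (erdos_renyi n (p n)) {G. property_A s G}) \<longlonglongrightarrow> 0"
proof -
  define k where "k = (s choose 2) - 1"
  \<comment> \<open>In these terms the threshold is \<Lambda> / g^2, where g^(s+1) = n, \<Lambda>^k
    = A ln n and \<open>A powr b\<close> is \<open>c_const s\<close>; n^\<beta> equals n^2 /
    g^2.\<close>
  define a b \<beta> A where "a = 1 / (real s + 1)" and "b = 1 / real k"
    and "\<beta> = 2 * (1 - 1 / (real s + 1))" and "A = \<beta> * fact (s - 2)"
  define \<Lambda> g M0 \<Delta> where "\<Lambda> n = (A * ln n) powr b" and "g n = n powr a" and "M0 n = \<Lambda> n / (4 * exp 1)"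
    and "\<Delta> n = 4 ^ (2 * s + 1) * (2 * real s + 1) * \<Lambda> n ^ (2 * k) / g n" for n :: nat
  \<comment> \<open>The errors of the sparse and the dense case are added, since which case applies
    may change with n.\<close>
  define bound where "bound J n = \<Lambda> n / g n + (1 / real J + real J *
    (2 * sqrt (exp (2 * \<Delta> n) / M0 n + (exp (2 * \<Delta> n) - 1 + 2 * (\<Lambda> n / (g n)\<^sup>2)))))" for J n :: nat
  define P where "P n = measure_pmf.prob (erdos_renyi n (p n)) {G. property_A s G}" for n

  have s: "3 \<le> s" by fact
  have k: "2 * k = (s - 2) * (s + 1)" unfolding k_def using s by (intro clique_exponent) auto
  have "0 < k" using k s by (cases "k = 0") auto
  have "2 * real k = real ((s - 2) * (s + 1))" using k by (metis of_nat_mult of_nat_numeral)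
  moreover have "real (s - 2) = real s - 2" using s by (simp add: of_nat_diff)
  ultimately have rk: "2 * real k = (real s - 2) * (real s + 1)"
    by (simp only: of_nat_mult of_nat_add of_nat_1)
  have ab: "0 < a" "0 < b" "b \<le> 1" "0 < 2 * a" using \<open>0 < k\<close> by (auto simp: a_def b_def)
  have \<beta>: "0 < \<beta>" "\<beta> = 2 - 2 * a" using s by (auto simp: \<beta>_def a_def field_simps)
  have A: "0 < A" using \<beta> by (simp add: A_def)

  have \<Lambda>k: "\<Lambda> n ^ k = A * ln n" if "2 \<le> n" for n
  proof -
    have pos: "0 < A * ln n" using A that by simp
    then have "\<Lambda> n ^ k = (A * ln n) powr (real k * b)"
      unfolding \<Lambda>_def by (intro powr_power) linarith
    also have "real k * b = 1" using \<open>0 < k\<close> by (simp add: b_def)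
    finally show ?thesis using pos by simp
  qed
  have gs: "g n ^ (s + 1) = n" and g2: "(g n)\<^sup>2 = n powr (2 * a)" if "2 \<le> n" for n
  proof -
    have "g n ^ (s + 1) = n powr (real (s + 1) * a)"
      unfolding g_def using that by (intro powr_power) simp
    also have "real (s + 1) * a = 1" by (simp add: a_def add.commute)
    finally show "g n ^ (s + 1) = n" using that by simp
    show "(g n)\<^sup>2 = n powr (2 * a)" using that by (simp add: g_def powr_power)
  qed
  have threshold: "c_const s * q_fun s n = \<Lambda> n / (g n)\<^sup>2" if "2 \<le> n" for n
  proof -
    have e: "2 / ((real s - 2) * (real s + 1)) = b" using \<open>0 < k\<close> by (simp add: b_def rk[symmetric])
    have "c_const s * q_fun s n = (A powr b * ln n powr b) * n powr (- (2 * a))"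
      unfolding c_const_def q_fun_def e by (simp add: A_def \<beta>_def a_def)
    also have "A powr b * ln n powr b = \<Lambda> n" using A that by (simp add: \<Lambda>_def powr_mult)
    also have "n powr (- (2 * a)) = 1 / (g n)\<^sup>2" using that by (simp only: g2 powr_minus_divide)
    finally show ?thesis by simp
  qed

  have lim_g: "(\<lambda>n. \<Lambda> n / g n) \<longlonglongrightarrow> 0"
    unfolding \<Lambda>_def g_def using A ab by (intro ln_powr_over_powr_tendsto_0)
  have "(\<lambda>n. \<Lambda> n / n powr (2 * a)) \<longlonglongrightarrow> 0"
    unfolding \<Lambda>_def using A ab by (intro ln_powr_over_powr_tendsto_0)
  then have lim_p: "(\<lambda>n. \<Lambda> n / (g n)\<^sup>2) \<longlonglongrightarrow> 0"
    by (rule Lim_transform_eventually) (use g2 in \<open>auto intro: eventually_sequentiallyI[of 2]\<close>)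
  have "(\<lambda>n. 4 ^ (2 * s + 1) * (2 * real s + 1) * (A * ln n)\<^sup>2 / n powr a) \<longlonglongrightarrow> 0"
    using A ab by (intro ln_squared_over_powr_tendsto_0)
  then have lim_\<Delta>: "\<Delta> \<longlonglongrightarrow> 0"
  proof (rule Lim_transform_eventually)
    have "\<Delta> n = 4 ^ (2 * s + 1) * (2 * real s + 1) * (A * ln n)\<^sup>2 / n powr a" if "2 \<le> n" for n
      unfolding \<Delta>_def g_def mult.commute[of 2 k] power_mult \<Lambda>k[OF that] ..
    then show "\<forall>\<^sub>F n in sequentially. 4 ^ (2 * s + 1) * (2 * real s + 1) * (A * ln n)\<^sup>2 / n powr a = \<Delta> n"
      by (auto intro!: eventually_sequentiallyI[of 2])
  qed
  have lim_M0: "filterlim M0 at_top sequentially"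
    unfolding M0_def \<Lambda>_def using A ab by (intro ln_powr_at_top)
  have lim_bound: "bound J \<longlonglongrightarrow> 1 / real J" for J
  proof -
    have e: "(\<lambda>n. exp (2 * \<Delta> n)) \<longlonglongrightarrow> exp (2 * 0)" by (intro tendsto_intros lim_\<Delta>)
    have "(\<lambda>n. exp (2 * \<Delta> n) / M0 n) \<longlonglongrightarrow> 0"
      by (rule real_tendsto_divide_at_top[OF e lim_M0])
    then have "bound J \<longlonglongrightarrow> 0 + (1 / real J + real J * (2 * sqrt (0 + (exp (2 * 0) - 1 + 2 * 0))))"
      unfolding bound_def by (intro tendsto_intros lim_g lim_p e)
    then show ?thesis by simp
  qed

  have P_le: "\<forall>\<^sub>F n in sequentially. P n \<le> bound J n" if J: "0 < J" for J
  proof -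
    have "\<forall>\<^sub>F n in sequentially. 2 \<le> \<beta> * ln (real n)" using ln_eventually_ge[OF \<beta>(1)] .
    moreover have "\<forall>\<^sub>F n in sequentially. 1 \<le> A * ln (real n)" using ln_eventually_ge[OF A] .
    moreover have "\<forall>\<^sub>F n in sequentially. 2 * (\<beta> * ln (real n)) * (A * ln (real n)) \<le> real n"
      using ln_squared_eventually_le[OF A \<beta>(1)] .
    moreover have "\<forall>\<^sub>F n in sequentially. \<Lambda> n / (g n)\<^sup>2 < 1 / 2"
      using order_tendstoD(2)[OF lim_p, of "1 / 2"] by simp
    moreover have "\<forall>\<^sub>F n in sequentially. 2 * s \<le> n" by (rule eventually_ge_at_top)
    ultimately show ?thesis using assms(3)
    proof eventually_elim
      case (elim n)
      have n: "2 \<le> n" "2 * s \<le> n" using elim s by auto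
      let ?V = "{1..n}" and ?pm = "\<Lambda> n / (g n)\<^sup>2"
      let ?W = "int ((s - 2) choose 2) + (int s - 2) * (int n - int s + 2)"
      have p_le: "p n \<le> ?pm" using elim threshold[OF n(1)] by simp
      also have "?pm < 1 / 2" using elim by simp
      finally have p: "0 \<le> p n" "p n \<le> 1" "p n < 1 / 2" using assms(2)[of n] by auto
      have \<Lambda>: "1 \<le> \<Lambda> n" using elim ab by (simp add: \<Lambda>_def ge_one_powr_ge_zero)
      have g: "1 \<le> g n" using n ab by (simp add: g_def ge_one_powr_ge_zero)
      have M0: "0 < M0 n" using \<Lambda> by (simp add: M0_def)
      have "0 \<le> \<Delta> n" using \<Lambda> g by (simp add: \<Delta>_def)
      have P: "P n = expect (p n) (all_pairs ?V)
          (\<lambda>\<omega>. of_bool (int (wsat (Graph ?V \<omega>) (complete_graph s)) = ?W))"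
        unfolding P_def using p by (subst prob_erdos_renyi) (simp_all add: property_A_def)
      define R where "R = 1 / real J + real J *
        (2 * sqrt (exp (2 * \<Delta> n) / M0 n + (exp (2 * \<Delta> n) - 1 + 2 * ?pm)))"
      have R: "0 \<le> R" unfolding R_def using M0 \<Lambda> g \<open>0 \<le> \<Delta> n\<close>
        by (intro add_nonneg_nonneg mult_nonneg_nonneg real_sqrt_ge_zero) auto
      have bound: "bound J n = \<Lambda> n / g n + R" by (simp add: bound_def R_def)
      show ?case
      \<comment> \<open>At this cut n p is at most \<Lambda> / g, which tends to 0, so Markov's
        inequality suffices below it. Above it, the ratio y of p to the threshold has
        \<open>ln y\<close> at least - L / 2 with L = \<beta> ln n.\<close>
      proof (cases "p n \<le> ?pm * n powr (- \<beta> / 2)")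
        case True
        \<comment> \<open>Since s - 2 >= 1 and n >= 2 s, the product alone is at least n - s + 2,
          hence at least n / 2.\<close>
        have W: "real n / 2 \<le> real_of_int ?W"
        proof -
          have "1 * (int n - int s + 2) \<le> (int s - 2) * (int n - int s + 2)"
            using s n by (intro mult_right_mono) auto
          moreover have "int n \<le> 2 * (C + X)" if "1 * (int n - int s + 2) \<le> X" "0 \<le> C" for C X
            using that n(2) by simp
          ultimately have "int n \<le> 2 * ?W" by simp
          moreover have "real n / 2 \<le> real_of_int W" if "int n \<le> 2 * W" for W
            using that by linarith
          ultimately show ?thesis by blast
        qed
        have "P n \<le> real (card ?V choose 2) * p n / (real n / 2)"
          unfolding P using p W s n by (intro prob_wsat_le) auto
        also have "\<dots> \<le> ((real n)\<^sup>2 / 2) * p n / (real n / 2)"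
        proof (intro divide_right_mono mult_right_mono)
          have "(n choose 2) * fact 2 \<le> n ^ 2" by (rule binomial_fact_pow)
          then have "real ((n choose 2) * fact 2) \<le> real (n ^ 2)" by (simp only: of_nat_le_iff)
          then show "real (card ?V choose 2) \<le> (real n)\<^sup>2 / 2" by simp
        qed (use p in auto)
        also have "\<dots> = real n * p n" using n by (simp add: power2_eq_square)
        also have "\<dots> \<le> real n * (?pm * n powr (- \<beta> / 2))" using True by (intro mult_left_mono) auto
        also have "\<dots> = \<Lambda> n * (n powr 1 * n powr (- (2 * a)) * n powr (- \<beta> / 2))"
          using n by (simp add: g2 powr_minus_divide)
        also have "n powr 1 * n powr (- (2 * a)) * n powr (- \<beta> / 2) = n powr (- a)"
          unfolding powr_add[symmetric] \<beta>(2) by (rule arg_cong[of _ _ "(powr) n"]) (simp add: field_simps)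
        also have "\<Lambda> n * n powr (- a) = \<Lambda> n / g n" by (simp add: g_def powr_minus_divide)
        finally show ?thesis using R bound by linarith
      next
        case False
        have pm: "0 < ?pm" using \<Lambda> g by simp
        define y where "y = p n / ?pm"
        have py: "p n = y * ?pm" using nonzero_eq_divide_eq[of ?pm y "p n"] pm y_def by (metis less_irrefl)
        have ylow: "n powr (- \<beta> / 2) \<le> y"
          using False unfolding y_def pos_le_divide_eq[OF pm] mult.commute[of _ ?pm] by linarith
        have "0 < y" using ylow n by (intro less_le_trans[OF _ ylow]) auto
        have "y \<le> 1" using p_le unfolding y_def pos_divide_le_eq[OF pm] by simp
        have "0 < p n" unfolding py using \<open>0 < y\<close> pm by (rule mult_pos_pos)
        have pk: "p n ^ k \<le> 1 / 2"
          using power_decreasing[of 1 k "p n"] p \<open>0 < k\<close> by simp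
        have "(real n)\<^sup>2 / (g n)\<^sup>2 = n powr \<beta>"
          using n unfolding g2[OF n(1)] \<beta>(2) powr_diff by simp
        then have count: "M0 n \<le> real (n choose 2) * p n * (1 - p n ^ k) ^ ((n - 2) choose (s - 2))"
          unfolding M0_def k_def
          using \<open>0 < y\<close> \<open>y \<le> 1\<close> ylow py p p_le pk elim n s \<beta> \<Lambda> g gs \<Lambda>k
          by (intro expected_count_lower[where A = A and \<beta> = \<beta> and y = y and g = "g n"])
            (auto simp: A_def k_def)
        \<comment> \<open>The required value is an integer; passing to \<open>nat\<close> can only
          enlarge the event.\<close>
        have "P n \<le> expect (p n) (all_pairs ?V)
            (\<lambda>\<omega>. of_bool (wsat (Graph ?V \<omega>) (complete_graph s) = nat ?W))"
          unfolding P using p by (intro expect_mono) auto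
        also have "\<dots> \<le> 1 / real J + real J *
            (2 * sqrt (exp (2 * \<Delta> n) / M0 n + (exp (2 * \<Delta> n) - 1 + 2 * p n)))"
          using n s p p_le pk \<open>0 < p n\<close> g gs \<Lambda> M0 count J
          by (intro wsat_anticoncentration[where g = "g n" and \<Lambda> = "\<Lambda> n"]) (auto simp: k_def \<Delta>_def)
        also have "\<dots> \<le> R"
          unfolding R_def using p_le by (intro add_left_mono mult_left_mono real_sqrt_le_mono) auto
        finally show ?thesis using bound \<Lambda> g by (simp add: add_increasing)
      qed
    qed
  qed

  have "P \<longlonglongrightarrow> 0"
  proof (rule order_tendstoI)
    fix \<epsilon> :: real assume "0 < \<epsilon>"
    \<comment> \<open>\<open>J\<close> depends on \<epsilon> alone and is fixed before n grows, so
      all error terms multiplied by \<open>J\<close> vanish in the limit.\<close>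
    then obtain J where J: "0 < J" "1 / real J < \<epsilon>"
      by (metis nat_approx_posE of_nat_Suc zero_less_Suc)
    have "\<forall>\<^sub>F n in sequentially. bound J n < \<epsilon>" using order_tendstoD(2)[OF lim_bound J(2)] .
    then show "\<forall>\<^sub>F n in sequentially. P n < \<epsilon>"
      using P_le[OF J(1)] by eventually_elim linarith
  next
    fix \<epsilon> :: real assume "\<epsilon> < 0"
    then show "\<forall>\<^sub>F n in sequentially. \<epsilon> < P n"
      by (intro always_eventually allI) (auto simp: P_def intro: less_le_trans)
  qed
  then show ?thesis by (simp add: P_def[abs_def])
qed

end
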